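(* In a differential category for which $\mathsf{J}:=\mathsf{d}^\circ\mathsf{d}+1:{!}\Rightarrow{!}$ is a natural isomorphism, the natural transformation $\mathsf{s}:=\mathsf{d}^\circ(\mathsf{J}^{-1}\otimes1)$, with components ${!}A\to{!}A\otimes A$, is an integral transformation, and $\mathsf{d}$ and $\mathsf{s}$ satisfy the Poincaré condition.
   Context: Conventions. Composition is in diagrammatic order: $fg$ means first $f$, then $g$. Symmetric monoidal categories are treated as strict; $\otimes$ is the tensor, $I$ the unit, $\sigma$ the symmetry, $1$ an identity map. An additive category is a category enriched in commutative monoids (no negatives or biproducts assumed): hom-sets have $+$ and $0$ with $k(f+g)h=kfh+kgh$, $0f=0$, $f0=0$. An additive symmetric monoidal category is a symmetric monoidal category that is additive with $k\otimes(f+g)\otimes h=k\otimes f\otimes h+k\otimes g\otimes h$, $0\otimes h=0$, $h\otimes 0=0$. A coalgebra modality $(!,\delta,\varepsilon,\Delta,e)$ is a comonad $(!,\delta,\varepsilon)$ with natural transformations $\Delta_A:{!}A\to{!}A\otimes{!}A$ and $e_A:{!}A\to I$ such that each $({!}A,\Delta_A,e_A)$ is a cocommutative comonoid and $\delta\Delta=\Delta(\delta\otimes\delta)$. The coderiving transformation is $\mathsf{d}^\circ_A=\Delta_A(1_{!A}\otimes\varepsilon_A):{!}A\to{!}A\otimes A$. A differential category is an additive symmetric monoidal category with a coalgebra modality and a deriving transformation: a natural transformation $\mathsf{d}_A:{!}A\otimes A\to{!}A$ such that [d.1] $\mathsf{d}e=0$; [d.2] $\mathsf{d}\Delta=(\Delta\otimes1)(1\otimes\sigma)(\mathsf{d}\otimes1)+(\Delta\otimes1)(1\otimes\mathsf{d})$;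 [d.3] $\mathsf{d}\varepsilon=e\otimes1$; [d.4] $\mathsf{d}\delta=(\Delta\otimes1)(\delta\otimes1\otimes1)(1\otimes\mathsf{d})\mathsf{d}$; [d.5] $(\mathsf{d}\otimes1)\mathsf{d}=(1\otimes\sigma)(\mathsf{d}\otimes1)\mathsf{d}$. An integral transformation for a coalgebra modality is a natural transformation $\mathsf{s}_A:{!}A\to{!}A\otimes A$ such that [s.1] $\mathsf{s}(e\otimes1)=\varepsilon$; [s.2] $\Delta(\mathsf{s}\otimes\mathsf{s})=\mathsf{s}(\Delta\otimes1)(\mathsf{s}\otimes1\otimes1)+\mathsf{s}(\Delta\otimes1)(1\otimes\sigma)(1\otimes1\otimes\mathsf{s})$; [s.3] $\mathsf{s}(\mathsf{s}\otimes1)=\mathsf{s}(\mathsf{s}\otimes1)(1\otimes\sigma)$. A deriving transformation $\mathsf{d}$ and an integral transformation $\mathsf{s}$ on the same coalgebra modality satisfy the Poincaré condition if for all objects $A,B,C$, every map $f:C\otimes{!}A\otimes A\to B$ with $(1\otimes1\otimes\sigma)(1\otimes\mathsf{d}\otimes1)f=(1\otimes\mathsf{d}\otimes1)f$ (as maps $C\otimes{!}A\otimes A\otimes A\to B$) satisfies $(1\otimes\mathsf{d}\mathsf{s})f=f$. *)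

theory Defs
  imports Main
begin

section \<open>Additive symmetric monoidal categories\<close>

text \<open>
  Composition is written in diagrammatic order: \<open>f \<cdot> g\<close> is first \<open>f\<close>, then \<open>g\<close>.
  The operations of the records below are meaningful only on objects in \<open>Obj\<close> and arrows
  in \<open>Arr\<close> (composable arrows, parallel arrows), and are unspecified elsewhere.
\<close>

record ('o, 'm) category =
  Obj :: "'o set"
  Arr :: "'m set"
  Dom :: "'m \<Rightarrow> 'o"
  Cod :: "'m \<Rightarrow> 'o"
  Id :: "'o \<Rightarrow> 'm"  ("\<one>\<index>")
  Comp :: "'m \<Rightarrow> 'm \<Rightarrow> 'm"  (infixl "\<cdot>\<index>" 70)

definition hom :: "('o, 'm, 'x) category_scheme \<Rightarrow> 'o \<Rightarrow> 'o \<Rightarrow> 'm set"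
  where "hom C A B = {f \<in> Arr C. Dom C f = A \<and> Cod C f = B}"

locale category =
  fixes C :: "('o, 'm, 'x) category_scheme" (structure)
  assumes dom_obj: "f \<in> Arr C \<Longrightarrow> Dom C f \<in> Obj C"
    and cod_obj: "f \<in> Arr C \<Longrightarrow> Cod C f \<in> Obj C"
    and id_hom: "A \<in> Obj C \<Longrightarrow> \<one> A \<in> hom C A A"
    and comp_hom: "\<lbrakk>f \<in> hom C A B; g \<in> hom C B D\<rbrakk> \<Longrightarrow> f \<cdot> g \<in> hom C A D"
    and comp_id_left: "f \<in> hom C A B \<Longrightarrow> \<one> A \<cdot> f = f"
    and comp_id_right: "f \<in> hom C A B \<Longrightarrow> f \<cdot> \<one> B = f"
    and comp_assoc: "\<lbrakk>f \<in> hom C A B; g \<in> hom C B D; h \<in> hom C D E\<rbrakk>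
      \<Longrightarrow> (f \<cdot> g) \<cdot> h = f \<cdot> (g \<cdot> h)"

definition inverse_arrows :: "('o, 'm, 'x) category_scheme \<Rightarrow> 'm \<Rightarrow> 'm \<Rightarrow> bool"
  where "inverse_arrows C f g \<longleftrightarrow>
    f \<in> Arr C \<and> g \<in> hom C (Cod C f) (Dom C f)
    \<and> f \<cdot>\<^bsub>C\<^esub> g = \<one>\<^bsub>C\<^esub> (Dom C f) \<and> g \<cdot>\<^bsub>C\<^esub> f = \<one>\<^bsub>C\<^esub> (Cod C f)"

definition iso :: "('o, 'm, 'x) category_scheme \<Rightarrow> 'm \<Rightarrow> bool"
  where "iso C f \<longleftrightarrow> (\<exists>g. inverse_arrows C f g)"

definition inverse_of :: "('o, 'm, 'x) category_scheme \<Rightarrow> 'm \<Rightarrow> 'm"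
  where "inverse_of C f = (THE g. inverse_arrows C f g)"

record ('o, 'm) symmetric_monoidal_category = "('o, 'm) category" +
  Tensor_obj :: "'o \<Rightarrow> 'o \<Rightarrow> 'o"  (infixr "\<boxtimes>\<index>" 75)
  Tensor :: "'m \<Rightarrow> 'm \<Rightarrow> 'm"  (infixr "\<otimes>\<index>" 75)
  Unit :: "'o"  ("\<I>\<index>")
  Sym :: "'o \<Rightarrow> 'o \<Rightarrow> 'm"  ("\<sigma>\<index>")

text \<open>
  Strictness: the associativity and unit constraints are identities, so that \<open>\<boxtimes>\<close> and \<open>\<otimes>\<close>
  are strictly associative and unital on objects and on arrows.
\<close>

locale strict_symmetric_monoidal_category = category C
  for C :: "('o, 'm, 'x) symmetric_monoidal_category_scheme" (structure) +
  assumes unit_obj: "\<I> \<in> Obj C"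
    and tensor_obj: "\<lbrakk>A \<in> Obj C; B \<in> Obj C\<rbrakk> \<Longrightarrow> A \<boxtimes> B \<in> Obj C"
    and tensor_hom: "\<lbrakk>f \<in> hom C A A'; g \<in> hom C B B'\<rbrakk> \<Longrightarrow> f \<otimes> g \<in> hom C (A \<boxtimes> B) (A' \<boxtimes> B')"
    and tensor_id: "\<lbrakk>A \<in> Obj C; B \<in> Obj C\<rbrakk> \<Longrightarrow> \<one> A \<otimes> \<one> B = \<one> (A \<boxtimes> B)"
    and tensor_comp: "\<lbrakk>f \<in> hom C A A'; f' \<in> hom C A' A''; g \<in> hom C B B'; g' \<in> hom C B' B''\<rbrakk>
      \<Longrightarrow> (f \<cdot> f') \<otimes> (g \<cdot> g') = (f \<otimes> g) \<cdot> (f' \<otimes> g')"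
    and tensor_obj_assoc: "\<lbrakk>A \<in> Obj C; B \<in> Obj C; D \<in> Obj C\<rbrakk>
      \<Longrightarrow> (A \<boxtimes> B) \<boxtimes> D = A \<boxtimes> (B \<boxtimes> D)"
    and tensor_obj_unit_left: "A \<in> Obj C \<Longrightarrow> \<I> \<boxtimes> A = A"
    and tensor_obj_unit_right: "A \<in> Obj C \<Longrightarrow> A \<boxtimes> \<I> = A"
    and tensor_assoc: "\<lbrakk>f \<in> Arr C; g \<in> Arr C; h \<in> Arr C\<rbrakk> \<Longrightarrow> (f \<otimes> g) \<otimes> h = f \<otimes> (g \<otimes> h)"
    and tensor_unit_left: "f \<in> Arr C \<Longrightarrow> \<one> \<I> \<otimes> f = f"
    and tensor_unit_right: "f \<in> Arr C \<Longrightarrow> f \<otimes> \<one> \<I> = f"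
    and sym_hom: "\<lbrakk>A \<in> Obj C; B \<in> Obj C\<rbrakk> \<Longrightarrow> \<sigma> A B \<in> hom C (A \<boxtimes> B) (B \<boxtimes> A)"
    and sym_natural: "\<lbrakk>f \<in> hom C A A'; g \<in> hom C B B'\<rbrakk>
      \<Longrightarrow> (f \<otimes> g) \<cdot> \<sigma> A' B' = \<sigma> A B \<cdot> (g \<otimes> f)"
    and sym_sym: "\<lbrakk>A \<in> Obj C; B \<in> Obj C\<rbrakk> \<Longrightarrow> \<sigma> A B \<cdot> \<sigma> B A = \<one> (A \<boxtimes> B)"
    and sym_unit: "A \<in> Obj C \<Longrightarrow> \<sigma> A \<I> = \<one> A"
    and sym_hexagon: "\<lbrakk>A \<in> Obj C; B \<in> Obj C; D \<in> Obj C\<rbrakk>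
      \<Longrightarrow> \<sigma> A (B \<boxtimes> D) = (\<sigma> A B \<otimes> \<one> D) \<cdot> (\<one> B \<otimes> \<sigma> A D)"

record ('o, 'm) additive_smc = "('o, 'm) symmetric_monoidal_category" +
  Plus :: "'m \<Rightarrow> 'm \<Rightarrow> 'm"  (infixl "\<oplus>\<index>" 65)
  Zero :: "'o \<Rightarrow> 'o \<Rightarrow> 'm"  ("\<zero>\<index>")

locale additive_symmetric_monoidal_category = strict_symmetric_monoidal_category C
  for C :: "('o, 'm, 'x) additive_smc_scheme" (structure) +
  assumes zero_hom: "\<lbrakk>A \<in> Obj C; B \<in> Obj C\<rbrakk> \<Longrightarrow> \<zero> A B \<in> hom C A B"
    and plus_hom: "\<lbrakk>f \<in> hom C A B; g \<in> hom C A B\<rbrakk> \<Longrightarrow> f \<oplus> g \<in> hom C A B"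
    and plus_assoc: "\<lbrakk>f \<in> hom C A B; g \<in> hom C A B; h \<in> hom C A B\<rbrakk>
      \<Longrightarrow> (f \<oplus> g) \<oplus> h = f \<oplus> (g \<oplus> h)"
    and plus_comm: "\<lbrakk>f \<in> hom C A B; g \<in> hom C A B\<rbrakk> \<Longrightarrow> f \<oplus> g = g \<oplus> f"
    and plus_zero: "f \<in> hom C A B \<Longrightarrow> f \<oplus> \<zero> A B = f"
    and comp_plus: "\<lbrakk>k \<in> hom C A B; f \<in> hom C B D; g \<in> hom C B D; h \<in> hom C D E\<rbrakk>
      \<Longrightarrow> k \<cdot> (f \<oplus> g) \<cdot> h = k \<cdot> f \<cdot> h \<oplus> k \<cdot> g \<cdot> h"
    and zero_comp: "\<lbrakk>A \<in> Obj C; f \<in> hom C B D\<rbrakk> \<Longrightarrow> \<zero> A B \<cdot> f = \<zero> A D"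
    and comp_zero: "\<lbrakk>f \<in> hom C A B; D \<in> Obj C\<rbrakk> \<Longrightarrow> f \<cdot> \<zero> B D = \<zero> A D"
    and tensor_plus: "\<lbrakk>k \<in> Arr C; f \<in> hom C A B; g \<in> hom C A B; h \<in> Arr C\<rbrakk>
      \<Longrightarrow> k \<otimes> (f \<oplus> g) \<otimes> h = k \<otimes> f \<otimes> h \<oplus> k \<otimes> g \<otimes> h"
    and zero_tensor: "\<lbrakk>A \<in> Obj C; B \<in> Obj C; h \<in> hom C D E\<rbrakk>
      \<Longrightarrow> \<zero> A B \<otimes> h = \<zero> (A \<boxtimes> D) (B \<boxtimes> E)"
    and tensor_zero: "\<lbrakk>h \<in> hom C D E; A \<in> Obj C; B \<in> Obj C\<rbrakk>
      \<Longrightarrow> h \<otimes> \<zero> A B = \<zero> (D \<boxtimes> A) (E \<boxtimes> B)"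


section \<open>Endofunctors and natural transformations\<close>

record ('o, 'm) endofunctor =
  OMap :: "'o \<Rightarrow> 'o"  (infixr "\<odot>" 90)
  AMap :: "'m \<Rightarrow> 'm"  (infixr "\<star>" 90)

definition endofunctor :: "('o, 'm, 'x) category_scheme \<Rightarrow> ('o, 'm) endofunctor \<Rightarrow> bool"
  where "endofunctor C F \<longleftrightarrow>
    (\<forall>A \<in> Obj C. F \<odot> A \<in> Obj C)
    \<and> (\<forall>A B. \<forall>f \<in> hom C A B. F \<star> f \<in> hom C (F \<odot> A) (F \<odot> B))
    \<and> (\<forall>A \<in> Obj C. F \<star> (\<one>\<^bsub>C\<^esub> A) = \<one>\<^bsub>C\<^esub> (F \<odot> A))
    \<and> (\<forall>A B D. \<forall>f \<in> hom C A B. \<forall>g \<in> hom C B D.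
          F \<star> (f \<cdot>\<^bsub>C\<^esub> g) = (F \<star> f) \<cdot>\<^bsub>C\<^esub> (F \<star> g))"

definition id_functor :: "('o, 'm) endofunctor"
  where "id_functor = \<lparr>OMap = (\<lambda>A. A), AMap = (\<lambda>f. f)\<rparr>"

definition comp_functor :: "('o, 'm) endofunctor \<Rightarrow> ('o, 'm) endofunctor \<Rightarrow> ('o, 'm) endofunctor"
  where "comp_functor F G = \<lparr>OMap = (\<lambda>A. G \<odot> F \<odot> A), AMap = (\<lambda>f. G \<star> F \<star> f)\<rparr>"

definition unit_functor ::
    "('o, 'm, 'x) symmetric_monoidal_category_scheme \<Rightarrow> ('o, 'm) endofunctor"
  where "unit_functor C = \<lparr>OMap = (\<lambda>A. \<I>\<^bsub>C\<^esub>), AMap = (\<lambda>f. \<one>\<^bsub>C\<^esub> \<I>\<^bsub>C\<^esub>)\<rparr>"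

definition tensor_functor ::
    "('o, 'm, 'x) symmetric_monoidal_category_scheme
      \<Rightarrow> ('o, 'm) endofunctor \<Rightarrow> ('o, 'm) endofunctor \<Rightarrow> ('o, 'm) endofunctor"
  where "tensor_functor C F G =
    \<lparr>OMap = (\<lambda>A. (F \<odot> A) \<boxtimes>\<^bsub>C\<^esub> (G \<odot> A)), AMap = (\<lambda>f. (F \<star> f) \<otimes>\<^bsub>C\<^esub> (G \<star> f))\<rparr>"

definition natural_transformation ::
    "('o, 'm, 'x) category_scheme
      \<Rightarrow> ('o, 'm) endofunctor \<Rightarrow> ('o, 'm) endofunctor \<Rightarrow> ('o \<Rightarrow> 'm) \<Rightarrow> bool"
  where "natural_transformation C F G \<alpha> \<longleftrightarrow>
    (\<forall>A \<in> Obj C. \<alpha> A \<in> hom C (F \<odot> A) (G \<odot> A))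
    \<and> (\<forall>A B. \<forall>f \<in> hom C A B. (F \<star> f) \<cdot>\<^bsub>C\<^esub> \<alpha> B = \<alpha> A \<cdot>\<^bsub>C\<^esub> (G \<star> f))"

definition natural_isomorphism ::
    "('o, 'm, 'x) category_scheme
      \<Rightarrow> ('o, 'm) endofunctor \<Rightarrow> ('o, 'm) endofunctor \<Rightarrow> ('o \<Rightarrow> 'm) \<Rightarrow> bool"
  where "natural_isomorphism C F G \<alpha> \<longleftrightarrow>
    natural_transformation C F G \<alpha> \<and> (\<forall>A \<in> Obj C. iso C (\<alpha> A))"


section \<open>Coalgebra modalities\<close>

locale comonad = category C
  for C :: "('o, 'm, 'x) category_scheme" (structure) +
  fixes Bang :: "('o, 'm) endofunctor"
    and \<delta> :: "'o \<Rightarrow> 'm"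
    and \<epsilon> :: "'o \<Rightarrow> 'm"
  assumes bang_functor: "endofunctor C Bang"
    and delta_natural: "natural_transformation C Bang (comp_functor Bang Bang) \<delta>"
    and epsilon_natural: "natural_transformation C Bang id_functor \<epsilon>"
    and delta_epsilon: "A \<in> Obj C \<Longrightarrow> \<delta> A \<cdot> \<epsilon> (Bang \<odot> A) = \<one> (Bang \<odot> A)"
    and delta_bang_epsilon: "A \<in> Obj C \<Longrightarrow> \<delta> A \<cdot> (Bang \<star> \<epsilon> A) = \<one> (Bang \<odot> A)"
    and delta_delta: "A \<in> Obj C \<Longrightarrow> \<delta> A \<cdot> \<delta> (Bang \<odot> A) = \<delta> A \<cdot> (Bang \<star> \<delta> A)"

definition cocommutative_comonoid ::
    "('o, 'm, 'x) symmetric_monoidal_category_scheme \<Rightarrow> 'o \<Rightarrow> 'm \<Rightarrow> 'm \<Rightarrow> bool"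
  where "cocommutative_comonoid C X c u \<longleftrightarrow>
    X \<in> Obj C \<and> c \<in> hom C X (X \<boxtimes>\<^bsub>C\<^esub> X) \<and> u \<in> hom C X \<I>\<^bsub>C\<^esub>
    \<and> c \<cdot>\<^bsub>C\<^esub> (c \<otimes>\<^bsub>C\<^esub> \<one>\<^bsub>C\<^esub> X) = c \<cdot>\<^bsub>C\<^esub> (\<one>\<^bsub>C\<^esub> X \<otimes>\<^bsub>C\<^esub> c)
    \<and> c \<cdot>\<^bsub>C\<^esub> (u \<otimes>\<^bsub>C\<^esub> \<one>\<^bsub>C\<^esub> X) = \<one>\<^bsub>C\<^esub> X
    \<and> c \<cdot>\<^bsub>C\<^esub> (\<one>\<^bsub>C\<^esub> X \<otimes>\<^bsub>C\<^esub> u) = \<one>\<^bsub>C\<^esub> X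
    \<and> c \<cdot>\<^bsub>C\<^esub> \<sigma>\<^bsub>C\<^esub> X X = c"

locale coalgebra_modality = strict_symmetric_monoidal_category C + comonad C Bang \<delta> \<epsilon>
  for C :: "('o, 'm, 'x) symmetric_monoidal_category_scheme" (structure)
    and Bang :: "('o, 'm) endofunctor"
    and \<delta> :: "'o \<Rightarrow> 'm"
    and \<epsilon> :: "'o \<Rightarrow> 'm" +
  fixes \<Delta> :: "'o \<Rightarrow> 'm"
    and e :: "'o \<Rightarrow> 'm"
  assumes Delta_natural: "natural_transformation C Bang (tensor_functor C Bang Bang) \<Delta>"
    and e_natural: "natural_transformation C Bang (unit_functor C) e"
    and comonoid: "A \<in> Obj C \<Longrightarrow> cocommutative_comonoid C (Bang \<odot> A) (\<Delta> A) (e A)"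
    and delta_Delta: "A \<in> Obj C \<Longrightarrow> \<delta> A \<cdot> \<Delta> (Bang \<odot> A) = \<Delta> A \<cdot> (\<delta> A \<otimes> \<delta> A)"

definition coderiving ::
    "('o, 'm, 'x) symmetric_monoidal_category_scheme
      \<Rightarrow> ('o, 'm) endofunctor \<Rightarrow> ('o \<Rightarrow> 'm) \<Rightarrow> ('o \<Rightarrow> 'm) \<Rightarrow> 'o \<Rightarrow> 'm"
  where "coderiving C Bang \<epsilon> \<Delta> A = \<Delta> A \<cdot>\<^bsub>C\<^esub> (\<one>\<^bsub>C\<^esub> (Bang \<odot> A) \<otimes>\<^bsub>C\<^esub> \<epsilon> A)"


section \<open>Differential categories, integral transformations, the Poincare condition\<close>

locale differential_category =
  additive_symmetric_monoidal_category C + coalgebra_modality C Bang \<delta> \<epsilon> \<Delta> e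
  for C :: "('o, 'm, 'x) additive_smc_scheme" (structure)
    and Bang :: "('o, 'm) endofunctor"
    and \<delta> :: "'o \<Rightarrow> 'm"
    and \<epsilon> :: "'o \<Rightarrow> 'm"
    and \<Delta> :: "'o \<Rightarrow> 'm"
    and e :: "'o \<Rightarrow> 'm" +
  fixes d :: "'o \<Rightarrow> 'm"
  assumes d_natural: "natural_transformation C (tensor_functor C Bang id_functor) Bang d"
    and d1: "A \<in> Obj C \<Longrightarrow> d A \<cdot> e A = \<zero> ((Bang \<odot> A) \<boxtimes> A) \<I>"
    and d2: "A \<in> Obj C \<Longrightarrow> d A \<cdot> \<Delta> A =
        (\<Delta> A \<otimes> \<one> A) \<cdot> (\<one> (Bang \<odot> A) \<otimes> \<sigma> (Bang \<odot> A) A) \<cdot> (d A \<otimes> \<one> (Bang \<odot> A))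
        \<oplus> (\<Delta> A \<otimes> \<one> A) \<cdot> (\<one> (Bang \<odot> A) \<otimes> d A)"
    and d3: "A \<in> Obj C \<Longrightarrow> d A \<cdot> \<epsilon> A = e A \<otimes> \<one> A"
    and d4: "A \<in> Obj C \<Longrightarrow> d A \<cdot> \<delta> A =
        (\<Delta> A \<otimes> \<one> A) \<cdot> (\<delta> A \<otimes> \<one> (Bang \<odot> A) \<otimes> \<one> A)
        \<cdot> (\<one> (Bang \<odot> Bang \<odot> A) \<otimes> d A) \<cdot> d (Bang \<odot> A)"
    and d5: "A \<in> Obj C \<Longrightarrow> (d A \<otimes> \<one> A) \<cdot> d A =
        (\<one> (Bang \<odot> A) \<otimes> \<sigma> A A) \<cdot> (d A \<otimes> \<one> A) \<cdot> d A"

locale integral_transformation =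
  additive_symmetric_monoidal_category C + coalgebra_modality C Bang \<delta> \<epsilon> \<Delta> e
  for C :: "('o, 'm, 'x) additive_smc_scheme" (structure)
    and Bang :: "('o, 'm) endofunctor"
    and \<delta> :: "'o \<Rightarrow> 'm"
    and \<epsilon> :: "'o \<Rightarrow> 'm"
    and \<Delta> :: "'o \<Rightarrow> 'm"
    and e :: "'o \<Rightarrow> 'm" +
  fixes s :: "'o \<Rightarrow> 'm"
  assumes s_natural: "natural_transformation C Bang (tensor_functor C Bang id_functor) s"
    and s1: "A \<in> Obj C \<Longrightarrow> s A \<cdot> (e A \<otimes> \<one> A) = \<epsilon> A"
    and s2: "A \<in> Obj C \<Longrightarrow> \<Delta> A \<cdot> (s A \<otimes> s A) =
        s A \<cdot> (\<Delta> A \<otimes> \<one> A) \<cdot> (s A \<otimes> \<one> (Bang \<odot> A) \<otimes> \<one> A)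
        \<oplus> s A \<cdot> (\<Delta> A \<otimes> \<one> A) \<cdot> (\<one> (Bang \<odot> A) \<otimes> \<sigma> (Bang \<odot> A) A)
          \<cdot> (\<one> (Bang \<odot> A) \<otimes> \<one> A \<otimes> s A)"
    and s3: "A \<in> Obj C \<Longrightarrow> s A \<cdot> (s A \<otimes> \<one> A) =
        s A \<cdot> (s A \<otimes> \<one> A) \<cdot> (\<one> (Bang \<odot> A) \<otimes> \<sigma> A A)"

definition poincare_condition ::
    "('o, 'm, 'x) symmetric_monoidal_category_scheme
      \<Rightarrow> ('o, 'm) endofunctor \<Rightarrow> ('o \<Rightarrow> 'm) \<Rightarrow> ('o \<Rightarrow> 'm) \<Rightarrow> bool"
  where "poincare_condition C Bang d s \<longleftrightarrow>
    (\<forall>A \<in> Obj C. \<forall>B \<in> Obj C. \<forall>D \<in> Obj C. \<forall>f \<in> hom C (D \<boxtimes>\<^bsub>C\<^esub> (Bang \<odot> A) \<boxtimes>\<^bsub>C\<^esub> A) B.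
      (\<one>\<^bsub>C\<^esub> D \<otimes>\<^bsub>C\<^esub> \<one>\<^bsub>C\<^esub> (Bang \<odot> A) \<otimes>\<^bsub>C\<^esub> \<sigma>\<^bsub>C\<^esub> A A) \<cdot>\<^bsub>C\<^esub> (\<one>\<^bsub>C\<^esub> D \<otimes>\<^bsub>C\<^esub> d A \<otimes>\<^bsub>C\<^esub> \<one>\<^bsub>C\<^esub> A) \<cdot>\<^bsub>C\<^esub> f
        = (\<one>\<^bsub>C\<^esub> D \<otimes>\<^bsub>C\<^esub> d A \<otimes>\<^bsub>C\<^esub> \<one>\<^bsub>C\<^esub> A) \<cdot>\<^bsub>C\<^esub> f
      \<longrightarrow> (\<one>\<^bsub>C\<^esub> D \<otimes>\<^bsub>C\<^esub> (d A \<cdot>\<^bsub>C\<^esub> s A)) \<cdot>\<^bsub>C\<^esub> f = f)"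

definition J_transformation ::
    "('o, 'm, 'x) additive_smc_scheme \<Rightarrow> ('o, 'm) endofunctor
      \<Rightarrow> ('o \<Rightarrow> 'm) \<Rightarrow> ('o \<Rightarrow> 'm) \<Rightarrow> ('o \<Rightarrow> 'm) \<Rightarrow> 'o \<Rightarrow> 'm"
  where "J_transformation C Bang \<epsilon> \<Delta> d A =
    coderiving C Bang \<epsilon> \<Delta> A \<cdot>\<^bsub>C\<^esub> d A \<oplus>\<^bsub>C\<^esub> \<one>\<^bsub>C\<^esub> (Bang \<odot> A)"

definition J_integral ::
    "('o, 'm, 'x) additive_smc_scheme \<Rightarrow> ('o, 'm) endofunctor
      \<Rightarrow> ('o \<Rightarrow> 'm) \<Rightarrow> ('o \<Rightarrow> 'm) \<Rightarrow> ('o \<Rightarrow> 'm) \<Rightarrow> 'o \<Rightarrow> 'm"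
  where "J_integral C Bang \<epsilon> \<Delta> d A =
    coderiving C Bang \<epsilon> \<Delta> A
    \<cdot>\<^bsub>C\<^esub> (inverse_of C (J_transformation C Bang \<epsilon> \<Delta> d A) \<otimes>\<^bsub>C\<^esub> \<one>\<^bsub>C\<^esub> A)"

end

theory Submission
  imports Defs
begin

text \<open>
  Write \<open>W = d\<^sup>\<circ> d\<close>, the Euler operator \<open>f \<mapsto> f'(x) x\<close>, so \<open>J = W + 1\<close>. Leibniz and chain
  rule give \<open>J d\<^sup>\<circ> = d\<^sup>\<circ> ((J + 1) \<otimes> 1)\<close>, \<open>d J = ((J + 1) \<otimes> 1) d\<close> and
  \<open>(J + 1) \<Delta> = \<Delta> (J \<otimes> 1 + 1 \<otimes> J)\<close>. The crucial point is that \<open>J + 1\<close> is invertible as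
  soon as \<open>J\<close> is: \<open>G = \<delta> J\<^sup>-\<^sup>1 d\<^sup>\<circ> (!\<epsilon> \<otimes> e)\<close>, with \<open>J\<^sup>-\<^sup>1\<close> and \<open>d\<^sup>\<circ>\<close> taken at
  \<open>!A\<close>, is its inverse. Then \<open>J\<^sup>-\<^sup>1\<close> commutes with \<open>d\<^sup>\<circ>\<close> and \<open>d\<close> up to a shift,
  \<open>J\<^sup>-\<^sup>1 d\<^sup>\<circ> = d\<^sup>\<circ> (G \<otimes> 1)\<close> and \<open>d J\<^sup>-\<^sup>1 = (G \<otimes> 1) d\<close>, which reduces [s.3] to cocommutativity,
  [s.2] to \<open>G \<Delta> (J\<^sup>-\<^sup>1 \<otimes> 1 + 1 \<otimes> J\<^sup>-\<^sup>1) = \<Delta> (J\<^sup>-\<^sup>1 \<otimes> J\<^sup>-\<^sup>1)\<close>, and the Poincare condition to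
  \<open>J\<^sup>-\<^sup>1 (W + 1) = 1\<close>.
\<close>

section \<open>Calculus in additive symmetric monoidal categories\<close>

context category
begin

lemma homI: "\<lbrakk>f \<in> Arr C; Dom C f = A; Cod C f = B\<rbrakk> \<Longrightarrow> f \<in> hom C A B"
  by (simp add: hom_def)

lemma homD:
  assumes "f \<in> hom C A B"
  shows "f \<in> Arr C" "Dom C f = A" "Cod C f = B"
  using assms by (simp_all add: hom_def)

lemma id_arr [simp]:
  assumes "A \<in> Obj C"
  shows "\<one> A \<in> Arr C" "Dom C (\<one> A) = A" "Cod C (\<one> A) = A"
  using homD[OF id_hom[OF assms]] .

lemma comp_arr [simp]:
  assumes "f \<in> Arr C" "g \<in> Arr C" "Cod C f = Dom C g"
  shows "f \<cdot> g \<in> Arr C" "Dom C (f \<cdot> g) = Dom C f" "Cod C (f \<cdot> g) = Cod C g"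
  using homD[OF comp_hom[of f "Dom C f" "Dom C g" g "Cod C g"]] assms by (simp_all add: hom_def)

lemma dom_cod_obj [simp]: "f \<in> Arr C \<Longrightarrow> Dom C f \<in> Obj C" "f \<in> Arr C \<Longrightarrow> Cod C f \<in> Obj C"
  by (simp_all add: dom_obj cod_obj)

lemma comp_id [simp]:
  "\<lbrakk>f \<in> Arr C; Dom C f = A\<rbrakk> \<Longrightarrow> \<one> A \<cdot> f = f"
  "\<lbrakk>f \<in> Arr C; Cod C f = A\<rbrakk> \<Longrightarrow> f \<cdot> \<one> A = f"
  by (auto intro: comp_id_left comp_id_right homI)

lemma assoc [simp]:
  "\<lbrakk>f \<in> Arr C; g \<in> Arr C; h \<in> Arr C; Cod C f = Dom C g; Cod C g = Dom C h\<rbrakk>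
    \<Longrightarrow> (f \<cdot> g) \<cdot> h = f \<cdot> (g \<cdot> h)"
  by (rule comp_assoc) (auto intro: homI)

text \<open>Composites are normalised to the right by \<open>assoc\<close>, so a known value of
  \<open>f \<cdot> g\<close> no longer matches inside a longer composite; this form does.\<close>

lemma rewrite_assoc:
  assumes "f \<cdot> g = k" "f \<in> Arr C" "g \<in> Arr C" "h \<in> Arr C" "Cod C f = Dom C g" "Cod C g = Dom C h"
  shows "f \<cdot> (g \<cdot> h) = k \<cdot> h"
  using assms assoc by metis

lemma inverse_arrows_unique:
  assumes "inverse_arrows C f g" "inverse_arrows C f h"
  shows "g = h"
proof -
  have "g = g \<cdot> (f \<cdot> h)" using assms by (auto simp: inverse_arrows_def hom_def)
  also have "\<dots> = (g \<cdot> f) \<cdot> h"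
    by (rule assoc[symmetric]) (use assms in \<open>auto simp: inverse_arrows_def hom_def\<close>)
  also have "\<dots> = h" using assms by (auto simp: inverse_arrows_def hom_def simp del: assoc)
  finally show ?thesis .
qed

lemma inverse_of_inverse:
  assumes "iso C f"
  shows "inverse_arrows C f (inverse_of C f)"
  using assms inverse_arrows_unique unfolding iso_def inverse_of_def
  by (metis (mono_tags, lifting) theI')

end

section \<open>Bifunctoriality and symmetry of the strict tensor\<close>

context strict_symmetric_monoidal_category
begin

declare unit_obj [simp] tensor_obj [simp] tensor_obj_assoc [simp]
  tensor_obj_unit_left [simp] tensor_obj_unit_right [simp]
  tensor_assoc [simp] tensor_unit_left [simp] tensor_unit_right [simp]

lemma tensor_arr [simp]:
  assumes "f \<in> Arr C" "g \<in> Arr C"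
  shows "f \<otimes> g \<in> Arr C" "Dom C (f \<otimes> g) = Dom C f \<boxtimes> Dom C g"
    "Cod C (f \<otimes> g) = Cod C f \<boxtimes> Cod C g"
  using homD[OF tensor_hom[of f "Dom C f" "Cod C f" g "Dom C g" "Cod C g"]] assms
  by (simp_all add: hom_def)

lemma sym_arr [simp]:
  assumes "A \<in> Obj C" "B \<in> Obj C"
  shows "\<sigma> A B \<in> Arr C" "Dom C (\<sigma> A B) = A \<boxtimes> B" "Cod C (\<sigma> A B) = B \<boxtimes> A"
  using homD[OF sym_hom[OF assms]] .

lemma id_tensor [simp]: "\<lbrakk>A \<in> Obj C; B \<in> Obj C\<rbrakk> \<Longrightarrow> \<one> (A \<boxtimes> B) = \<one> A \<otimes> \<one> B"
  by (simp add: tensor_id)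

text \<open>Since \<open>id_tensor\<close> splits the identity of a tensor product, the unit laws
  must be available for split identities on two and three factors.\<close>

lemma comp_id_tensor [simp]:
  "\<lbrakk>A \<in> Obj C; B \<in> Obj C; f \<in> Arr C; Dom C f = A \<boxtimes> B\<rbrakk> \<Longrightarrow> (\<one> A \<otimes> \<one> B) \<cdot> f = f"
  "\<lbrakk>A \<in> Obj C; B \<in> Obj C; f \<in> Arr C; Cod C f = A \<boxtimes> B\<rbrakk> \<Longrightarrow> f \<cdot> (\<one> A \<otimes> \<one> B) = f"
  "\<lbrakk>A \<in> Obj C; B \<in> Obj C; D \<in> Obj C; f \<in> Arr C; Dom C f = A \<boxtimes> B \<boxtimes> D\<rbrakk>
    \<Longrightarrow> (\<one> A \<otimes> \<one> B \<otimes> \<one> D) \<cdot> f = f"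
  "\<lbrakk>A \<in> Obj C; B \<in> Obj C; D \<in> Obj C; f \<in> Arr C; Cod C f = A \<boxtimes> B \<boxtimes> D\<rbrakk>
    \<Longrightarrow> f \<cdot> (\<one> A \<otimes> \<one> B \<otimes> \<one> D) = f"
  by (simp_all flip: id_tensor)

lemma interchange:
  "\<lbrakk>f \<in> Arr C; f' \<in> Arr C; g \<in> Arr C; g' \<in> Arr C; Cod C f = Dom C f'; Cod C g = Dom C g'\<rbrakk>
    \<Longrightarrow> (f \<otimes> g) \<cdot> (f' \<otimes> g') = (f \<cdot> f') \<otimes> (g \<cdot> g')"
  by (rule tensor_comp[symmetric]) (auto intro: homI)

lemma whisker_right:
  "\<lbrakk>f \<in> Arr C; g \<in> Arr C; Cod C f = Dom C g; A \<in> Obj C\<rbrakk>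
    \<Longrightarrow> (f \<cdot> g) \<otimes> \<one> A = (f \<otimes> \<one> A) \<cdot> (g \<otimes> \<one> A)"
  by (simp add: interchange)

lemma whisker_right_tensor:
  "\<lbrakk>f \<in> Arr C; g \<in> Arr C; Cod C f = Dom C g; A \<in> Obj C; B \<in> Obj C\<rbrakk>
    \<Longrightarrow> (f \<cdot> g) \<otimes> \<one> A \<otimes> \<one> B = (f \<otimes> \<one> A \<otimes> \<one> B) \<cdot> (g \<otimes> \<one> A \<otimes> \<one> B)"
  by (simp add: interchange)

lemma whisker_left:
  "\<lbrakk>f \<in> Arr C; g \<in> Arr C; Cod C f = Dom C g; A \<in> Obj C\<rbrakk>
    \<Longrightarrow> \<one> A \<otimes> (f \<cdot> g) = (\<one> A \<otimes> f) \<cdot> (\<one> A \<otimes> g)"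
  by (simp add: interchange)

lemma tensor_left_first:
  "\<lbrakk>f \<in> Arr C; g \<in> Arr C\<rbrakk> \<Longrightarrow> (f \<otimes> \<one> (Dom C g)) \<cdot> (\<one> (Cod C f) \<otimes> g) = f \<otimes> g"
  by (simp add: interchange)

lemma tensor_right_first:
  "\<lbrakk>f \<in> Arr C; g \<in> Arr C\<rbrakk> \<Longrightarrow> (\<one> (Dom C f) \<otimes> g) \<cdot> (f \<otimes> \<one> (Cod C g)) = f \<otimes> g"
  by (simp add: interchange)

text \<open>Maps on different factors commute, both sides being \<open>f \<otimes> g\<close>. Most
  string-diagram moves below are instances of this.\<close>

lemma slide:
  "\<lbrakk>f \<in> Arr C; g \<in> Arr C\<rbrakk> \<Longrightarrow>
    (\<one> (Dom C f) \<otimes> g) \<cdot> (f \<otimes> \<one> (Cod C g)) = (f \<otimes> \<one> (Dom C g)) \<cdot> (\<one> (Cod C f) \<otimes> g)"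
  by (simp add: interchange)

lemma sym_nat:
  "\<lbrakk>f \<in> Arr C; g \<in> Arr C; Cod C f = A; Cod C g = B\<rbrakk>
    \<Longrightarrow> (f \<otimes> g) \<cdot> \<sigma> A B = \<sigma> (Dom C f) (Dom C g) \<cdot> (g \<otimes> f)"
  by (rule sym_natural) (auto intro: homI)

lemma sym_unit_left:
  assumes [simp]: "A \<in> Obj C"
  shows "\<sigma> \<I> A = \<one> A"
  using sym_sym[of A \<I>] by (simp add: sym_unit)

text \<open>The right side is the inverse of the expansion of
  \<open>\<sigma> D (A \<boxtimes> B)\<close> given by \<open>sym_hexagon\<close>. The left side
  inverts the same map, and inverses are unique.\<close>

lemma sym_hexagon':
  assumes [simp]: "A \<in> Obj C" "B \<in> Obj C" "D \<in> Obj C"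
  shows "\<sigma> (A \<boxtimes> B) D = (\<one> A \<otimes> \<sigma> B D) \<cdot> (\<sigma> A D \<otimes> \<one> B)"
proof -
  let ?p = "(\<one> A \<otimes> \<sigma> B D) \<cdot> (\<sigma> A D \<otimes> \<one> B)"
  have inv: "?p \<cdot> \<sigma> D (A \<boxtimes> B) = \<one> (A \<boxtimes> B \<boxtimes> D)"
  proof -
    have "?p \<cdot> \<sigma> D (A \<boxtimes> B)
        = (\<one> A \<otimes> \<sigma> B D) \<cdot> (((\<sigma> A D \<cdot> \<sigma> D A) \<otimes> \<one> B) \<cdot> (\<one> A \<otimes> \<sigma> D B))"
      by (simp add: sym_hexagon whisker_right)
    also have "\<dots> = \<one> A \<otimes> (\<sigma> B D \<cdot> \<sigma> D B)"
      by (simp add: sym_sym interchange)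
    finally show ?thesis by (simp add: sym_sym)
  qed
  have "\<sigma> (A \<boxtimes> B) D = (?p \<cdot> \<sigma> D (A \<boxtimes> B)) \<cdot> \<sigma> (A \<boxtimes> B) D"
    by (simp add: inv del: assoc)
  also have "\<dots> = ?p \<cdot> (\<sigma> D (A \<boxtimes> B) \<cdot> \<sigma> (A \<boxtimes> B) D)"
    by (rule assoc) simp_all
  also have "\<dots> = ?p"
    by (simp add: sym_sym)
  finally show ?thesis .
qed

end

section \<open>Zero maps and distributivity\<close>

context additive_symmetric_monoidal_category
begin

lemma zero_arr [simp]:
  assumes "A \<in> Obj C" "B \<in> Obj C"
  shows "\<zero> A B \<in> Arr C" "Dom C (\<zero> A B) = A" "Cod C (\<zero> A B) = B"
  using homD[OF zero_hom[OF assms]] .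

lemma plus_arr [simp]:
  assumes "f \<in> Arr C" "g \<in> Arr C" "Dom C g = Dom C f" "Cod C g = Cod C f"
  shows "f \<oplus> g \<in> Arr C" "Dom C (f \<oplus> g) = Dom C f" "Cod C (f \<oplus> g) = Cod C f"
  using homD[OF plus_hom[of f "Dom C f" "Cod C f" g]] assms by (simp_all add: hom_def)

lemma zero_plus [simp]:
  "\<lbrakk>f \<in> Arr C; Dom C f = A; Cod C f = B\<rbrakk> \<Longrightarrow> f \<oplus> \<zero> A B = f"
  "\<lbrakk>f \<in> Arr C; Dom C f = A; Cod C f = B\<rbrakk> \<Longrightarrow> \<zero> A B \<oplus> f = f"
  using plus_zero[of f A B] plus_comm[of f A B "\<zero> A B"] dom_cod_obj[of f] zero_hom[of A B]
  by (auto simp: hom_def)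

lemma plus_ac:
  "\<lbrakk>f \<in> Arr C; g \<in> Arr C; Dom C g = Dom C f; Cod C g = Cod C f\<rbrakk> \<Longrightarrow> f \<oplus> g = g \<oplus> f"
  by (rule plus_comm) (auto intro: homI)

lemma plus_assoc':
  "\<lbrakk>f \<in> Arr C; g \<in> Arr C; h \<in> Arr C; Dom C g = Dom C f; Cod C g = Cod C f;
    Dom C h = Dom C f; Cod C h = Cod C f\<rbrakk> \<Longrightarrow> f \<oplus> g \<oplus> h = f \<oplus> (g \<oplus> h)"
  by (rule plus_assoc) (auto intro: homI)

lemma comp_zero' [simp]:
  "\<lbrakk>f \<in> Arr C; Cod C f = A; B \<in> Obj C\<rbrakk> \<Longrightarrow> f \<cdot> \<zero> A B = \<zero> (Dom C f) B"
  "\<lbrakk>f \<in> Arr C; Dom C f = B; A \<in> Obj C\<rbrakk> \<Longrightarrow> \<zero> A B \<cdot> f = \<zero> A (Cod C f)"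
  by (auto intro: comp_zero zero_comp homI)

lemma tensor_zero' [simp]:
  "\<lbrakk>f \<in> Arr C; A \<in> Obj C; B \<in> Obj C\<rbrakk> \<Longrightarrow> f \<otimes> \<zero> A B = \<zero> (Dom C f \<boxtimes> A) (Cod C f \<boxtimes> B)"
  "\<lbrakk>f \<in> Arr C; A \<in> Obj C; B \<in> Obj C\<rbrakk> \<Longrightarrow> \<zero> A B \<otimes> f = \<zero> (A \<boxtimes> Dom C f) (B \<boxtimes> Cod C f)"
  by (auto intro: tensor_zero zero_tensor homI)

text \<open>The axioms distribute on both sides at once. Here and in the next three lemmas one side
  is specialised to an identity, on \<open>\<I>\<close> in the case of tensors.\<close>

lemma distrib_left:
  assumes "k \<in> Arr C" "f \<in> Arr C" "g \<in> Arr C" "Cod C k = Dom C f" "Dom C g = Dom C f" "Cod C g = Cod C f"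
  shows "k \<cdot> (f \<oplus> g) = k \<cdot> f \<oplus> k \<cdot> g"
  using comp_plus[of k "Dom C k" "Cod C k" f "Cod C f" g "\<one> (Cod C f)" "Cod C f"] assms
  by (simp add: hom_def)

lemma distrib_right:
  assumes "h \<in> Arr C" "f \<in> Arr C" "g \<in> Arr C" "Dom C h = Cod C f" "Dom C g = Dom C f" "Cod C g = Cod C f"
  shows "(f \<oplus> g) \<cdot> h = f \<cdot> h \<oplus> g \<cdot> h"
  using comp_plus[of "\<one> (Dom C f)" "Dom C f" "Dom C f" f "Cod C f" g h "Cod C h"] assms
  by (simp add: hom_def)

lemma tensor_distrib_left:
  assumes "k \<in> Arr C" "f \<in> Arr C" "g \<in> Arr C" "Dom C g = Dom C f" "Cod C g = Cod C f"
  shows "k \<otimes> (f \<oplus> g) = k \<otimes> f \<oplus> k \<otimes> g"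
  using tensor_plus[of k f "Dom C f" "Cod C f" g "\<one> \<I>"] assms by (simp add: hom_def)

lemma tensor_distrib_right:
  assumes "h \<in> Arr C" "f \<in> Arr C" "g \<in> Arr C" "Dom C g = Dom C f" "Cod C g = Cod C f"
  shows "(f \<oplus> g) \<otimes> h = f \<otimes> h \<oplus> g \<otimes> h"
  using tensor_plus[of "\<one> \<I>" f "Dom C f" "Cod C f" g h] assms by (simp add: hom_def)

lemmas distribs = distrib_left distrib_right tensor_distrib_left tensor_distrib_right

end

section \<open>The coderiving transformation and the Euler operator\<close>

context coalgebra_modality
begin

abbreviation X :: "'o \<Rightarrow> 'o" where "X A \<equiv> Bang \<odot> A"

abbreviation dc :: "'o \<Rightarrow> 'm" where "dc \<equiv> coderiving C Bang \<epsilon> \<Delta>"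

lemma bang_obj [simp]: "A \<in> Obj C \<Longrightarrow> X A \<in> Obj C"
  using bang_functor by (simp add: endofunctor_def)

lemma bang_arr [simp]:
  assumes "f \<in> Arr C"
  shows "Bang \<star> f \<in> Arr C" "Dom C (Bang \<star> f) = X (Dom C f)" "Cod C (Bang \<star> f) = X (Cod C f)"
  using assms bang_functor by (auto simp: endofunctor_def hom_def)

lemma bang_comp:
  assumes "f \<in> Arr C" "g \<in> Arr C" "Cod C f = Dom C g"
  shows "Bang \<star> (f \<cdot> g) = (Bang \<star> f) \<cdot> (Bang \<star> g)"
  using assms bang_functor by (auto simp: endofunctor_def hom_def)

lemma structure_arr [simp]:
  assumes "A \<in> Obj C"
  shows "\<delta> A \<in> Arr C" "Dom C (\<delta> A) = X A" "Cod C (\<delta> A) = X (X A)"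
    "\<epsilon> A \<in> Arr C" "Dom C (\<epsilon> A) = X A" "Cod C (\<epsilon> A) = A"
    "\<Delta> A \<in> Arr C" "Dom C (\<Delta> A) = X A" "Cod C (\<Delta> A) = X A \<boxtimes> X A"
    "e A \<in> Arr C" "Dom C (e A) = X A" "Cod C (e A) = \<I>"
  using assms delta_natural epsilon_natural Delta_natural e_natural
  by (auto simp: natural_transformation_def hom_def comp_functor_def id_functor_def
      tensor_functor_def unit_functor_def)

lemma dc_arr [simp]:
  assumes "A \<in> Obj C"
  shows "dc A \<in> Arr C" "Dom C (dc A) = X A" "Cod C (dc A) = X A \<boxtimes> A"
  using assms by (simp_all add: coderiving_def)

lemma naturality:
  assumes "f \<in> Arr C" "Dom C f = A" "Cod C f = B"
  shows "(Bang \<star> f) \<cdot> \<delta> B = \<delta> A \<cdot> (Bang \<star> Bang \<star> f)"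
    "(Bang \<star> f) \<cdot> \<epsilon> B = \<epsilon> A \<cdot> f"
    "(Bang \<star> f) \<cdot> \<Delta> B = \<Delta> A \<cdot> ((Bang \<star> f) \<otimes> (Bang \<star> f))"
    "(Bang \<star> f) \<cdot> e B = e A"
  using assms delta_natural epsilon_natural Delta_natural e_natural
  by (auto simp: natural_transformation_def hom_def comp_functor_def id_functor_def
      tensor_functor_def unit_functor_def)

lemma comonoid_laws:
  assumes "A \<in> Obj C"
  shows coassoc: "\<Delta> A \<cdot> (\<Delta> A \<otimes> \<one> (X A)) = \<Delta> A \<cdot> (\<one> (X A) \<otimes> \<Delta> A)"
    and counit: "\<Delta> A \<cdot> (e A \<otimes> \<one> (X A)) = \<one> (X A)" "\<Delta> A \<cdot> (\<one> (X A) \<otimes> e A) = \<one> (X A)"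
    and cocomm: "\<Delta> A \<cdot> \<sigma> (X A) (X A) = \<Delta> A"
  using comonoid[OF assms] by (simp_all add: cocommutative_comonoid_def)

lemma dc_natural:
  assumes [simp]: "f \<in> Arr C" "Dom C f = A" "Cod C f = B"
  shows "(Bang \<star> f) \<cdot> dc B = dc A \<cdot> ((Bang \<star> f) \<otimes> f)"
proof -
  have [simp]: "A \<in> Obj C" "B \<in> Obj C" using dom_cod_obj[of f] by simp_all
  have "(Bang \<star> f) \<cdot> dc B = ((Bang \<star> f) \<cdot> \<Delta> B) \<cdot> (\<one> (X B) \<otimes> \<epsilon> B)"
    by (simp add: coderiving_def)
  also have "\<dots> = \<Delta> A \<cdot> ((Bang \<star> f) \<otimes> ((Bang \<star> f) \<cdot> \<epsilon> B))"
    by (simp add: naturality(3)[of f A B] interchange)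
  also have "\<dots> = \<Delta> A \<cdot> ((Bang \<star> f) \<otimes> (\<epsilon> A \<cdot> f))"
    by (simp add: naturality(2)[of f A B])
  also have "\<dots> = dc A \<cdot> ((Bang \<star> f) \<otimes> f)"
    by (simp add: coderiving_def interchange)
  finally show ?thesis .
qed

lemma dc_counit:
  assumes [simp]: "A \<in> Obj C"
  shows "dc A \<cdot> (e A \<otimes> \<one> A) = \<epsilon> A"
proof -
  have "dc A \<cdot> (e A \<otimes> \<one> A) = \<Delta> A \<cdot> ((\<one> (X A) \<otimes> \<epsilon> A) \<cdot> (e A \<otimes> \<one> A))"
    by (simp add: coderiving_def)
  also have "\<dots> = (\<Delta> A \<cdot> (e A \<otimes> \<one> (X A))) \<cdot> \<epsilon> A"
    using slide[of "e A" "\<epsilon> A"] by simp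
  also have "\<dots> = \<epsilon> A" by (simp add: counit)
  finally show ?thesis .
qed

text \<open>Coassociativity with \<open>\<epsilon>\<close> applied to the third of three
  copies.\<close>

lemma dc_Delta:
  assumes [simp]: "A \<in> Obj C"
  shows "dc A \<cdot> (\<Delta> A \<otimes> \<one> A) = \<Delta> A \<cdot> (\<one> (X A) \<otimes> dc A)"
proof -
  have "dc A \<cdot> (\<Delta> A \<otimes> \<one> A) = \<Delta> A \<cdot> ((\<one> (X A) \<otimes> \<epsilon> A) \<cdot> (\<Delta> A \<otimes> \<one> A))"
    by (simp add: coderiving_def)
  also have "\<dots> = (\<Delta> A \<cdot> (\<Delta> A \<otimes> \<one> (X A))) \<cdot> (\<one> (X A) \<otimes> \<one> (X A) \<otimes> \<epsilon> A)"
    using slide[of "\<Delta> A" "\<epsilon> A"] by simp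
  also have "\<dots> = \<Delta> A \<cdot> (\<one> (X A) \<otimes> dc A)"
    by (simp add: coassoc whisker_left coderiving_def)
  finally show ?thesis .
qed

text \<open>Cocommutativity allows the copy fed to \<open>\<epsilon>\<close> to be taken on the left
  instead of the right; coassociativity then regroups the three copies.\<close>

lemma dc_Delta_sym:
  assumes [simp]: "A \<in> Obj C"
  shows "dc A \<cdot> (\<Delta> A \<otimes> \<one> A) \<cdot> (\<one> (X A) \<otimes> \<sigma> (X A) A) = \<Delta> A \<cdot> (dc A \<otimes> \<one> (X A))"
proof -
  have "dc A \<cdot> \<sigma> (X A) A = \<Delta> A \<cdot> ((\<one> (X A) \<otimes> \<epsilon> A) \<cdot> \<sigma> (X A) A)"
    by (simp add: coderiving_def)
  also have "\<dots> = (\<Delta> A \<cdot> \<sigma> (X A) (X A)) \<cdot> (\<epsilon> A \<otimes> \<one> (X A))"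
    by (simp add: sym_nat)
  also have "\<dots> = \<Delta> A \<cdot> (\<epsilon> A \<otimes> \<one> (X A))"
    by (simp add: cocomm)
  finally have eq: "dc A \<cdot> \<sigma> (X A) A = \<Delta> A \<cdot> (\<epsilon> A \<otimes> \<one> (X A))" .
  have "dc A \<cdot> (\<Delta> A \<otimes> \<one> A) \<cdot> (\<one> (X A) \<otimes> \<sigma> (X A) A)
      = \<Delta> A \<cdot> (\<one> (X A) \<otimes> (dc A \<cdot> \<sigma> (X A) A))"
    by (simp only: dc_Delta assms) (simp add: interchange)
  also have "\<dots> = (\<Delta> A \<cdot> (\<one> (X A) \<otimes> \<Delta> A)) \<cdot> (\<one> (X A) \<otimes> \<epsilon> A \<otimes> \<one> (X A))"
    by (simp add: eq whisker_left)
  also have "\<dots> = \<Delta> A \<cdot> ((\<Delta> A \<otimes> \<one> (X A)) \<cdot> (\<one> (X A) \<otimes> \<epsilon> A \<otimes> \<one> (X A)))"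
    by (simp flip: coassoc)
  also have "\<dots> = \<Delta> A \<cdot> (dc A \<otimes> \<one> (X A))"
    by (simp add: coderiving_def whisker_right)
  finally show ?thesis .
qed

text \<open>This is \<open>dc_Delta_sym\<close> with \<open>\<epsilon>\<close> applied to the last
  copy: the two extracted arguments come from copies that cocommutativity may swap. It is the source
  of [s.3].\<close>

lemma dc_dc_sym:
  assumes [simp]: "A \<in> Obj C"
  shows "dc A \<cdot> (dc A \<otimes> \<one> A) \<cdot> (\<one> (X A) \<otimes> \<sigma> A A) = dc A \<cdot> (dc A \<otimes> \<one> A)"
proof -
  have "dc A \<cdot> (dc A \<otimes> \<one> A) \<cdot> (\<one> (X A) \<otimes> \<sigma> A A)
      = dc A \<cdot> ((\<Delta> A \<otimes> \<one> A) \<cdot> (\<one> (X A) \<otimes> ((\<epsilon> A \<otimes> \<one> A) \<cdot> \<sigma> A A)))"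
    by (simp add: coderiving_def whisker_right whisker_left)
  also have "\<dots> = (dc A \<cdot> (\<Delta> A \<otimes> \<one> A) \<cdot> (\<one> (X A) \<otimes> \<sigma> (X A) A)) \<cdot> (\<one> (X A) \<otimes> \<one> A \<otimes> \<epsilon> A)"
    by (simp add: sym_nat whisker_left)
  also have "\<dots> = \<Delta> A \<cdot> ((dc A \<otimes> \<one> (X A)) \<cdot> (\<one> (X A) \<otimes> \<one> A \<otimes> \<epsilon> A))"
    by (simp only: dc_Delta_sym assms) simp
  also have "\<dots> = dc A \<cdot> (dc A \<otimes> \<one> A)"
    using slide[of "dc A" "\<epsilon> A"] by (simp add: coderiving_def)
  finally show ?thesis .
qed

end

section \<open>Commutation rules for \<open>d\<close>, the Euler operator and
  \<open>J\<close>\<close>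

context differential_category
begin

abbreviation W :: "'o \<Rightarrow> 'm" where "W A \<equiv> dc A \<cdot> d A"

abbreviation J :: "'o \<Rightarrow> 'm" where "J \<equiv> J_transformation C Bang \<epsilon> \<Delta> d"

lemma d_arr [simp]:
  assumes "A \<in> Obj C"
  shows "d A \<in> Arr C" "Dom C (d A) = X A \<boxtimes> A" "Cod C (d A) = X A"
  using assms d_natural
  by (auto simp: natural_transformation_def hom_def tensor_functor_def id_functor_def)

lemma d_nat:
  assumes "f \<in> Arr C" "Dom C f = A" "Cod C f = B"
  shows "((Bang \<star> f) \<otimes> f) \<cdot> d B = d A \<cdot> (Bang \<star> f)"
  using assms d_natural
  by (auto simp: natural_transformation_def hom_def tensor_functor_def id_functor_def)

lemma J_arr [simp]:
  assumes "A \<in> Obj C"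
  shows "J A \<in> Arr C" "Dom C (J A) = X A" "Cod C (J A) = X A"
  using assms by (simp_all add: J_transformation_def)

text \<open>A canonical commutation relation. Apply \<open>\<epsilon>\<close> to the second output
  in [d.2]: in the first summand it slides through the symmetry and turns \<open>\<Delta>\<close>
  into \<open>dc\<close>, in the second [d.3] and the counit law leave the identity.\<close>

lemma d_dc:
  assumes [simp]: "A \<in> Obj C"
  shows "d A \<cdot> dc A
    = (dc A \<otimes> \<one> A) \<cdot> (\<one> (X A) \<otimes> \<sigma> A A) \<cdot> (d A \<otimes> \<one> A) \<oplus> \<one> (X A \<boxtimes> A)"
proof -
  have 1: "(\<Delta> A \<otimes> \<one> A) \<cdot> (\<one> (X A) \<otimes> \<sigma> (X A) A) \<cdot> (d A \<otimes> \<one> (X A)) \<cdot> (\<one> (X A) \<otimes> \<epsilon> A)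
      = (dc A \<otimes> \<one> A) \<cdot> (\<one> (X A) \<otimes> \<sigma> A A) \<cdot> (d A \<otimes> \<one> A)"
  proof -
    have "(\<Delta> A \<otimes> \<one> A) \<cdot> (\<one> (X A) \<otimes> \<sigma> (X A) A) \<cdot> (d A \<otimes> \<one> (X A)) \<cdot> (\<one> (X A) \<otimes> \<epsilon> A)
        = (\<Delta> A \<otimes> \<one> A) \<cdot> ((\<one> (X A) \<otimes> (\<sigma> (X A) A \<cdot> (\<one> A \<otimes> \<epsilon> A))) \<cdot> (d A \<otimes> \<one> A))"
      using slide[of "d A" "\<epsilon> A"] by (simp add: whisker_left)
    also have "\<sigma> (X A) A \<cdot> (\<one> A \<otimes> \<epsilon> A) = (\<epsilon> A \<otimes> \<one> A) \<cdot> \<sigma> A A"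
      by (simp add: sym_nat)
    finally show ?thesis by (simp add: coderiving_def whisker_left whisker_right)
  qed
  have 2: "(\<Delta> A \<otimes> \<one> A) \<cdot> (\<one> (X A) \<otimes> d A) \<cdot> (\<one> (X A) \<otimes> \<epsilon> A) = \<one> (X A \<boxtimes> A)"
  proof -
    have "(\<Delta> A \<otimes> \<one> A) \<cdot> (\<one> (X A) \<otimes> d A) \<cdot> (\<one> (X A) \<otimes> \<epsilon> A)
        = (\<Delta> A \<otimes> \<one> A) \<cdot> (\<one> (X A) \<otimes> (d A \<cdot> \<epsilon> A))"
      by (simp add: whisker_left)
    also have "\<dots> = (\<Delta> A \<cdot> (\<one> (X A) \<otimes> e A)) \<otimes> \<one> A"
      by (simp add: d3 whisker_right)
    finally show ?thesis by (simp add: counit)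
  qed
  have "d A \<cdot> dc A = (d A \<cdot> \<Delta> A) \<cdot> (\<one> (X A) \<otimes> \<epsilon> A)"
    by (simp add: coderiving_def)
  also have "\<dots> = (\<Delta> A \<otimes> \<one> A) \<cdot> (\<one> (X A) \<otimes> \<sigma> (X A) A) \<cdot> (d A \<otimes> \<one> (X A)) \<cdot> (\<one> (X A) \<otimes> \<epsilon> A)
      \<oplus> (\<Delta> A \<otimes> \<one> A) \<cdot> (\<one> (X A) \<otimes> d A) \<cdot> (\<one> (X A) \<otimes> \<epsilon> A)"
    by (simp add: d2 distrib_right)
  finally show ?thesis by (simp only: 1 2)
qed

lemma J_eq: "J A = W A \<oplus> \<one> (X A)"
  by (simp add: J_transformation_def)

text \<open>The swap coming from \<open>d_dc\<close> is absorbed by [d.5], and the summand 1 of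
  \<open>d_dc\<close> raises \<open>W\<close> to \<open>J\<close>: a shift by one degree.\<close>

lemma d_W:
  assumes [simp]: "A \<in> Obj C"
  shows "d A \<cdot> W A = (J A \<otimes> \<one> A) \<cdot> d A"
proof -
  have "d A \<cdot> W A = (d A \<cdot> dc A) \<cdot> d A" by simp
  also have "\<dots> = (dc A \<otimes> \<one> A) \<cdot> ((\<one> (X A) \<otimes> \<sigma> A A) \<cdot> (d A \<otimes> \<one> A) \<cdot> d A) \<oplus> d A"
    by (simp add: d_dc distrib_right)
  also have "\<dots> = (dc A \<otimes> \<one> A) \<cdot> ((d A \<otimes> \<one> A) \<cdot> d A) \<oplus> d A"
    by (simp only: d5[OF assms, symmetric])
  also have "\<dots> = (J A \<otimes> \<one> A) \<cdot> d A"
    by (simp add: J_eq distribs whisker_right)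
  finally show ?thesis .
qed

text \<open>Dual to \<open>d_W\<close>: here \<open>dc_dc_sym\<close> absorbs the swap.\<close>

lemma W_dc:
  assumes [simp]: "A \<in> Obj C"
  shows "W A \<cdot> dc A = dc A \<cdot> (J A \<otimes> \<one> A)"
proof -
  have "W A \<cdot> dc A = dc A \<cdot> (d A \<cdot> dc A)" by simp
  also have "\<dots> = (dc A \<cdot> (dc A \<otimes> \<one> A) \<cdot> (\<one> (X A) \<otimes> \<sigma> A A)) \<cdot> (d A \<otimes> \<one> A) \<oplus> dc A"
    by (simp add: d_dc distrib_left)
  also have "\<dots> = dc A \<cdot> ((dc A \<otimes> \<one> A) \<cdot> (d A \<otimes> \<one> A)) \<oplus> dc A"
    by (simp only: dc_dc_sym assms) simp
  also have "\<dots> = dc A \<cdot> (J A \<otimes> \<one> A)"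
    by (simp add: J_eq distribs whisker_right)
  finally show ?thesis .
qed

text \<open>The Euler operator is a derivation: precomposing [d.2] with \<open>dc\<close>, the two
  summands are regrouped by \<open>dc_Delta_sym\<close> and \<open>dc_Delta\<close>.\<close>

lemma W_Delta:
  assumes [simp]: "A \<in> Obj C"
  shows "W A \<cdot> \<Delta> A = \<Delta> A \<cdot> (W A \<otimes> \<one> (X A)) \<oplus> \<Delta> A \<cdot> (\<one> (X A) \<otimes> W A)"
proof -
  have "W A \<cdot> \<Delta> A = dc A \<cdot> (d A \<cdot> \<Delta> A)" by simp
  also have "\<dots> = (dc A \<cdot> (\<Delta> A \<otimes> \<one> A) \<cdot> (\<one> (X A) \<otimes> \<sigma> (X A) A)) \<cdot> (d A \<otimes> \<one> (X A))
      \<oplus> (dc A \<cdot> (\<Delta> A \<otimes> \<one> A)) \<cdot> (\<one> (X A) \<otimes> d A)"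
    by (simp add: d2 distrib_left)
  also have "\<dots> = (\<Delta> A \<cdot> (dc A \<otimes> \<one> (X A))) \<cdot> (d A \<otimes> \<one> (X A))
      \<oplus> (\<Delta> A \<cdot> (\<one> (X A) \<otimes> dc A)) \<cdot> (\<one> (X A) \<otimes> d A)"
    by (simp only: dc_Delta_sym assms) (simp only: dc_Delta assms)
  also have "\<dots> = \<Delta> A \<cdot> (W A \<otimes> \<one> (X A)) \<oplus> \<Delta> A \<cdot> (\<one> (X A) \<otimes> W A)"
    by (simp add: whisker_left whisker_right)
  finally show ?thesis .
qed

text \<open>Euler's identity in degree one, since \<open>\<epsilon>\<close> is the linear part;
  degree zero is \<open>J_e\<close>.\<close>

lemma W_epsilon:
  assumes [simp]: "A \<in> Obj C"
  shows "W A \<cdot> \<epsilon> A = \<epsilon> A"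
  by (simp add: d3 dc_counit)

lemma J_e:
  assumes [simp]: "A \<in> Obj C"
  shows "J A \<cdot> e A = e A"
  by (simp add: J_eq distrib_right d1)

lemma J_nat:
  assumes [simp]: "f \<in> Arr C" "Dom C f = A" "Cod C f = B"
  shows "(Bang \<star> f) \<cdot> J B = J A \<cdot> (Bang \<star> f)"
proof -
  have [simp]: "A \<in> Obj C" "B \<in> Obj C" using dom_cod_obj[of f] by simp_all
  have "(Bang \<star> f) \<cdot> W B = ((Bang \<star> f) \<cdot> dc B) \<cdot> d B" by simp
  also have "\<dots> = dc A \<cdot> (((Bang \<star> f) \<otimes> f) \<cdot> d B)" by (simp add: dc_natural[of f A B])
  also have "\<dots> = W A \<cdot> (Bang \<star> f)" by (simp add: d_nat[of f A B])
  finally have "(Bang \<star> f) \<cdot> W B = W A \<cdot> (Bang \<star> f)" .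
  then show ?thesis by (simp add: J_eq distribs)
qed

lemma J_dc:
  assumes [simp]: "A \<in> Obj C"
  shows "J A \<cdot> dc A = dc A \<cdot> ((J A \<oplus> \<one> (X A)) \<otimes> \<one> A)"
proof -
  have "J A \<cdot> dc A = W A \<cdot> dc A \<oplus> dc A" by (simp add: J_eq distrib_right)
  also have "\<dots> = dc A \<cdot> (J A \<otimes> \<one> A) \<oplus> dc A" by (simp only: W_dc assms)
  also have "\<dots> = dc A \<cdot> ((J A \<oplus> \<one> (X A)) \<otimes> \<one> A)" by (simp add: distribs)
  finally show ?thesis .
qed

lemma d_J:
  assumes [simp]: "A \<in> Obj C"
  shows "d A \<cdot> J A = ((J A \<oplus> \<one> (X A)) \<otimes> \<one> A) \<cdot> d A"
proof -
  have "d A \<cdot> J A = d A \<cdot> W A \<oplus> d A" by (simp add: J_eq distrib_left)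
  also have "\<dots> = (J A \<otimes> \<one> A) \<cdot> d A \<oplus> d A" by (simp only: d_W assms)
  also have "\<dots> = ((J A \<oplus> \<one> (X A)) \<otimes> \<one> A) \<cdot> d A" by (simp add: distribs)
  finally show ?thesis .
qed

text \<open>As \<open>J + 1\<close> is \<open>W + 2\<close>, each tensor factor receives one of the
  two identities, which completes its \<open>W\<close> to \<open>J\<close>.\<close>

lemma J_Delta:
  assumes [simp]: "A \<in> Obj C"
  shows "(J A \<oplus> \<one> (X A)) \<cdot> \<Delta> A = \<Delta> A \<cdot> (J A \<otimes> \<one> (X A) \<oplus> \<one> (X A) \<otimes> J A)"
proof -
  have "(J A \<oplus> \<one> (X A)) \<cdot> \<Delta> A = W A \<cdot> \<Delta> A \<oplus> \<Delta> A \<oplus> \<Delta> A"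
    by (simp add: J_eq distrib_right)
  also have "\<dots> = \<Delta> A \<cdot> (W A \<otimes> \<one> (X A)) \<oplus> \<Delta> A \<cdot> (\<one> (X A) \<otimes> W A) \<oplus> \<Delta> A \<oplus> \<Delta> A"
    by (simp only: W_Delta assms)
  also have "\<dots> = (\<Delta> A \<cdot> (W A \<otimes> \<one> (X A)) \<oplus> \<Delta> A) \<oplus> (\<Delta> A \<cdot> (\<one> (X A) \<otimes> W A) \<oplus> \<Delta> A)"
    by (simp add: plus_assoc' plus_ac[of "\<Delta> A" "\<Delta> A \<cdot> (\<one> (X A) \<otimes> W A) \<oplus> \<Delta> A"])
  also have "\<dots> = \<Delta> A \<cdot> (J A \<otimes> \<one> (X A) \<oplus> \<one> (X A) \<otimes> J A)"
    by (simp add: J_eq distribs)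
  finally show ?thesis .
qed

text \<open>
  The Euler operator of a composite: in function notation, where \<open>\<delta>\<close> is the universal
  non-linear map \<open>\<eta>\<close>, this is \<open>(\<Phi> \<circ> \<eta>)'(x) x = \<Phi>'(\<eta> x) (\<eta>'(x) x)\<close>.
\<close>
lemma W_delta:
  assumes [simp]: "A \<in> Obj C"
  shows "W A \<cdot> \<delta> A = \<Delta> A \<cdot> (\<delta> A \<otimes> W A) \<cdot> d (X A)"
proof -
  have "W A \<cdot> \<delta> A = dc A \<cdot> (d A \<cdot> \<delta> A)" by simp
  also have "\<dots> = (dc A \<cdot> (\<Delta> A \<otimes> \<one> A)) \<cdot> (((\<delta> A \<otimes> \<one> (X A) \<otimes> \<one> A) \<cdot> (\<one> (X (X A)) \<otimes> d A)) \<cdot> d (X A))"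
    by (simp add: d4)
  also have "(\<delta> A \<otimes> \<one> (X A) \<otimes> \<one> A) \<cdot> (\<one> (X (X A)) \<otimes> d A) = \<delta> A \<otimes> d A"
    using tensor_left_first[of "\<delta> A" "d A"] by simp
  also have "(dc A \<cdot> (\<Delta> A \<otimes> \<one> A)) \<cdot> ((\<delta> A \<otimes> d A) \<cdot> d (X A))
      = \<Delta> A \<cdot> (((\<one> (X A) \<otimes> dc A) \<cdot> (\<delta> A \<otimes> d A)) \<cdot> d (X A))"
    by (simp add: dc_Delta)
  also have "(\<one> (X A) \<otimes> dc A) \<cdot> (\<delta> A \<otimes> d A) = \<delta> A \<otimes> W A"
    by (simp add: interchange)
  finally show ?thesis by simp
qed

text \<open>\<open>\<delta>\<close> is compatible with copying, and \<open>\<epsilon>\<close>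
  cancels it on the second copy. Together with \<open>W_delta\<close> this allows the comparison
  made in \<open>J_G\<close>.\<close>

lemma delta_dc:
  assumes [simp]: "A \<in> Obj C"
  shows "\<delta> A \<cdot> dc (X A) = \<Delta> A \<cdot> (\<delta> A \<otimes> \<one> (X A))"
proof -
  have "\<delta> A \<cdot> dc (X A) = (\<delta> A \<cdot> \<Delta> (X A)) \<cdot> (\<one> (X (X A)) \<otimes> \<epsilon> (X A))"
    by (simp add: coderiving_def)
  also have "\<dots> = \<Delta> A \<cdot> (\<delta> A \<otimes> (\<delta> A \<cdot> \<epsilon> (X A)))"
    by (simp add: delta_Delta interchange)
  finally show ?thesis by (simp add: delta_epsilon)
qed

end

section \<open>Inverting \<open>J\<close> and \<open>J + 1\<close>\<close>

locale differential_category_J = differential_category C Bang \<delta> \<epsilon> \<Delta> e d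
  for C :: "('o, 'm, 'x) additive_smc_scheme" (structure)
    and Bang :: "('o, 'm) endofunctor"
    and \<delta> \<epsilon> \<Delta> e d :: "'o \<Rightarrow> 'm" +
  assumes J_iso: "natural_isomorphism C Bang Bang (J_transformation C Bang \<epsilon> \<Delta> d)"
begin

abbreviation Ji :: "'o \<Rightarrow> 'm" where "Ji A \<equiv> inverse_of C (J A)"

lemma Ji_arr [simp]:
  assumes "A \<in> Obj C"
  shows "Ji A \<in> Arr C" "Dom C (Ji A) = X A" "Cod C (Ji A) = X A"
    and J_Ji [simp]: "J A \<cdot> Ji A = \<one> (X A)" and Ji_J [simp]: "Ji A \<cdot> J A = \<one> (X A)"
proof -
  have "inverse_arrows C (J A) (Ji A)"
    using inverse_of_inverse J_iso assms by (simp add: natural_isomorphism_def)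
  then show "Ji A \<in> Arr C" "Dom C (Ji A) = X A" "Cod C (Ji A) = X A"
    "J A \<cdot> Ji A = \<one> (X A)" "Ji A \<cdot> J A = \<one> (X A)"
    using assms by (simp_all add: inverse_arrows_def hom_def)
qed

lemma J_Ji_comp [simp]:
  assumes "A \<in> Obj C" "f \<in> Arr C" "Dom C f = X A"
  shows "J A \<cdot> (Ji A \<cdot> f) = f" "Ji A \<cdot> (J A \<cdot> f) = f"
  using assms rewrite_assoc[OF J_Ji, of A f] rewrite_assoc[OF Ji_J, of A f] by simp_all

lemma Ji_nat:
  assumes [simp]: "f \<in> Arr C" "Dom C f = A" "Cod C f = B"
  shows "(Bang \<star> f) \<cdot> Ji B = Ji A \<cdot> (Bang \<star> f)"
proof -
  have [simp]: "A \<in> Obj C" "B \<in> Obj C" using dom_cod_obj[of f] by simp_all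
  have "(Bang \<star> f) \<cdot> Ji B = Ji A \<cdot> ((J A \<cdot> (Bang \<star> f)) \<cdot> Ji B)" by simp
  also have "\<dots> = Ji A \<cdot> (((Bang \<star> f) \<cdot> J B) \<cdot> Ji B)" by (simp only: J_nat[OF assms])
  finally show ?thesis by simp
qed

text \<open>\<open>J_dc\<close> solved for \<open>dc A\<close>. The factor \<open>J + 1\<close>
  stays on the right because its inverse is not yet available.\<close>

lemma Ji_dc_J:
  assumes [simp]: "A \<in> Obj C"
  shows "Ji A \<cdot> (dc A \<cdot> ((J A \<oplus> \<one> (X A)) \<otimes> \<one> A)) = dc A"
  by (simp flip: J_dc)

lemma Ji_e:
  assumes [simp]: "A \<in> Obj C"
  shows "Ji A \<cdot> e A = e A"
proof -
  have "Ji A \<cdot> e A = Ji A \<cdot> (J A \<cdot> e A)" by (simp only: J_e assms)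
  then show ?thesis by simp
qed

text \<open>
  Writing \<open>J\<^sup>-\<^sup>1 f\<close> as the average of \<open>f (t x)\<close> over \<open>t\<close> in the unit interval, \<open>Psi\<close> sends
  \<open>f\<close> to the average of \<open>\<Phi> (t u)\<close> with \<open>\<Phi> u = f (\<epsilon> u) * e u\<close>. At \<open>u = \<eta> x\<close> one has
  \<open>\<epsilon> (t u) = t x\<close> and \<open>e (t u) = t\<close>, so \<open>G\<close> is the average of \<open>t * f (t x)\<close>, which
  is what the inverse of \<open>J + 1\<close> has to be.
\<close>
definition Psi :: "'o \<Rightarrow> 'm"
  where "Psi A = Ji (X A) \<cdot> dc (X A) \<cdot> ((Bang \<star> \<epsilon> A) \<otimes> e A)"

definition G :: "'o \<Rightarrow> 'm"
  where "G A = \<delta> A \<cdot> Psi A"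

lemma Psi_G_arr [simp]:
  assumes "A \<in> Obj C"
  shows "Psi A \<in> Arr C" "Dom C (Psi A) = X (X A)" "Cod C (Psi A) = X A"
    "G A \<in> Arr C" "Dom C (G A) = X A" "Cod C (G A) = X A"
  using assms by (simp_all add: Psi_def G_def)

text \<open>This is \<open>G\<close> with \<open>Ji\<close> removed; it is the identity to which
  both halves of the inversion of \<open>J + 1\<close> reduce.\<close>

lemma delta_dc_counits:
  assumes [simp]: "A \<in> Obj C"
  shows "\<delta> A \<cdot> (dc (X A) \<cdot> ((Bang \<star> \<epsilon> A) \<otimes> e A)) = \<one> (X A)"
proof -
  have "\<delta> A \<cdot> (dc (X A) \<cdot> ((Bang \<star> \<epsilon> A) \<otimes> e A))
      = (\<delta> A \<cdot> dc (X A)) \<cdot> ((Bang \<star> \<epsilon> A) \<otimes> e A)" by simp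
  also have "\<dots> = \<Delta> A \<cdot> ((\<delta> A \<cdot> (Bang \<star> \<epsilon> A)) \<otimes> e A)"
    by (simp add: delta_dc interchange)
  finally show ?thesis by (simp add: delta_bang_epsilon counit)
qed

text \<open>By naturality \<open>J + 1\<close> moves in front of
  \<open>Bang \<star> \<epsilon> A\<close>, and there \<open>Ji_dc_J\<close> at \<open>X A\<close>
  absorbs it together with \<open>Ji\<close>.\<close>

lemma G_J:
  assumes [simp]: "A \<in> Obj C"
  shows "G A \<cdot> (J A \<oplus> \<one> (X A)) = \<one> (X A)"
proof -
  \<comment> \<open>Since \<open>e A\<close> ends in \<open>\<I>\<close>, a map composed afterwards
    acts on the first factor alone.\<close>
  have "((Bang \<star> \<epsilon> A) \<otimes> e A) \<cdot> (J A \<oplus> \<one> (X A)) = ((Bang \<star> \<epsilon> A) \<cdot> (J A \<oplus> \<one> (X A))) \<otimes> e A"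
    using interchange[of "Bang \<star> \<epsilon> A" "J A \<oplus> \<one> (X A)" "e A" "\<one> \<I>"] by simp
  also have "(Bang \<star> \<epsilon> A) \<cdot> (J A \<oplus> \<one> (X A)) = (J (X A) \<oplus> \<one> (X (X A))) \<cdot> (Bang \<star> \<epsilon> A)"
    by (simp add: distribs J_nat[of "\<epsilon> A" "X A" A])
  finally have E: "((Bang \<star> \<epsilon> A) \<otimes> e A) \<cdot> (J A \<oplus> \<one> (X A))
      = ((J (X A) \<oplus> \<one> (X (X A))) \<otimes> \<one> (X A)) \<cdot> ((Bang \<star> \<epsilon> A) \<otimes> e A)"
    by (simp add: interchange)
  have "G A \<cdot> (J A \<oplus> \<one> (X A))
      = \<delta> A \<cdot> (Ji (X A) \<cdot> (dc (X A) \<cdot> (((Bang \<star> \<epsilon> A) \<otimes> e A) \<cdot> (J A \<oplus> \<one> (X A)))))"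
    by (simp add: G_def Psi_def)
  also have "\<dots> = \<delta> A \<cdot> ((Ji (X A) \<cdot> (dc (X A) \<cdot> ((J (X A) \<oplus> \<one> (X (X A))) \<otimes> \<one> (X A))))
      \<cdot> ((Bang \<star> \<epsilon> A) \<otimes> e A))"
    unfolding E by simp
  also have "\<dots> = \<one> (X A)"
    unfolding Ji_dc_J[of "X A", simplified] by (simp add: delta_dc_counits)
  finally show ?thesis .
qed

text \<open>Only the half \<open>G_J\<close> enters, so this is available for \<open>d_Psi\<close>,
  on which the other half \<open>J_G\<close> rests.\<close>

lemma d_Ji:
  assumes [simp]: "A \<in> Obj C"
  shows "d A \<cdot> Ji A = (G A \<otimes> \<one> A) \<cdot> d A"
proof -
  have "(G A \<otimes> \<one> A) \<cdot> d A = (G A \<otimes> \<one> A) \<cdot> ((d A \<cdot> J A) \<cdot> Ji A)" by simp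
  also have "\<dots> = ((G A \<cdot> (J A \<oplus> \<one> (X A))) \<otimes> \<one> A) \<cdot> (d A \<cdot> Ji A)"
    by (simp only: d_J assms) (simp add: whisker_right)
  finally show ?thesis by (simp add: G_J)
qed

text \<open>Every ingredient of \<open>G\<close> is natural; the last one,
  \<open>Bang \<star> \<epsilon> A\<close>, commutes with itself by naturality of
  \<open>\<epsilon>\<close>. \<open>J_G\<close> uses it to bring \<open>G\<close> from
  \<open>X A\<close> down to \<open>A\<close>.\<close>

lemma G_nat_epsilon:
  assumes [simp]: "A \<in> Obj C"
  shows "(Bang \<star> \<epsilon> A) \<cdot> G A = G (X A) \<cdot> (Bang \<star> \<epsilon> A)"
proof -
  let ?f = "Bang \<star> \<epsilon> A"
  have "?f \<cdot> G A = (?f \<cdot> \<delta> A) \<cdot> Ji (X A) \<cdot> dc (X A) \<cdot> (?f \<otimes> e A)"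
    by (simp add: G_def Psi_def)
  also have "\<dots> = \<delta> (X A) \<cdot> ((Bang \<star> ?f) \<cdot> Ji (X A)) \<cdot> dc (X A) \<cdot> (?f \<otimes> e A)"
    by (simp add: naturality(1)[of "\<epsilon> A" "X A" A])
  also have "\<dots> = \<delta> (X A) \<cdot> Ji (X (X A)) \<cdot> ((Bang \<star> ?f) \<cdot> dc (X A)) \<cdot> (?f \<otimes> e A)"
    by (simp add: Ji_nat[of ?f "X (X A)" "X A"])
  also have "\<dots> = \<delta> (X A) \<cdot> Ji (X (X A)) \<cdot> dc (X (X A)) \<cdot> (((Bang \<star> ?f) \<cdot> ?f) \<otimes> (?f \<cdot> e A))"
    by (simp add: dc_natural[of ?f "X (X A)" "X A"] interchange)
  also have "(Bang \<star> ?f) \<cdot> ?f = (Bang \<star> \<epsilon> (X A)) \<cdot> ?f"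
  proof -
    have "Bang \<star> (?f \<cdot> \<epsilon> A) = Bang \<star> (\<epsilon> (X A) \<cdot> \<epsilon> A)"
      by (simp add: naturality(2)[of "\<epsilon> A" "X A" A])
    then show ?thesis by (simp add: bang_comp)
  qed
  also have "?f \<cdot> e A = e (X A)" by (simp add: naturality(4)[of "\<epsilon> A" "X A" A])
  also have "((Bang \<star> \<epsilon> (X A)) \<cdot> ?f) \<otimes> e (X A) = ((Bang \<star> \<epsilon> (X A)) \<otimes> e (X A)) \<cdot> ?f"
    using interchange[of "Bang \<star> \<epsilon> (X A)" ?f "e (X A)" "\<one> \<I>"] by simp
  finally show ?thesis by (simp add: G_def Psi_def)
qed

text \<open>\<open>d_Ji\<close> moves \<open>d\<close> past \<open>Ji\<close>, and
  \<open>d_dc\<close> splits the rest. The direction of differentiation enters the first summand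
  only through \<open>\<epsilon> A\<close> and the second only through \<open>e A\<close>.\<close>

lemma d_Psi:
  assumes [simp]: "A \<in> Obj C"
  shows "d (X A) \<cdot> Psi A
    = ((G (X A) \<cdot> dc (X A) \<cdot> ((Bang \<star> \<epsilon> A) \<otimes> e A)) \<otimes> \<epsilon> A) \<cdot> d A
      \<oplus> (G (X A) \<cdot> (Bang \<star> \<epsilon> A)) \<otimes> e A"
proof -
  let ?E = "(Bang \<star> \<epsilon> A) \<otimes> e A"
  \<comment> \<open>The symmetry moves the direction past the argument of \<open>e A\<close>; as
    \<open>e A\<close> ends in the unit object, what remains of the symmetry is an identity.\<close>
  have E: "(\<one> (X (X A)) \<otimes> \<sigma> (X A) (X A)) \<cdot> ((d (X A) \<otimes> \<one> (X A)) \<cdot> ?E) = (?E \<otimes> \<epsilon> A) \<cdot> d A"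
  proof -
    have "(d (X A) \<otimes> \<one> (X A)) \<cdot> ?E = (d (X A) \<cdot> (Bang \<star> \<epsilon> A)) \<otimes> e A"
      by (simp add: interchange)
    also have "\<dots> = (((Bang \<star> \<epsilon> A) \<otimes> \<epsilon> A) \<cdot> d A) \<otimes> e A"
      by (simp add: d_nat[of "\<epsilon> A" "X A" A])
    also have "\<dots> = ((Bang \<star> \<epsilon> A) \<otimes> \<epsilon> A \<otimes> e A) \<cdot> d A"
      using interchange[of "(Bang \<star> \<epsilon> A) \<otimes> \<epsilon> A" "d A" "e A" "\<one> \<I>"] by simp
    finally have "(\<one> (X (X A)) \<otimes> \<sigma> (X A) (X A)) \<cdot> ((d (X A) \<otimes> \<one> (X A)) \<cdot> ?E)
        = ((\<one> (X (X A)) \<otimes> \<sigma> (X A) (X A)) \<cdot> ((Bang \<star> \<epsilon> A) \<otimes> \<epsilon> A \<otimes> e A)) \<cdot> d A"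
      by simp
    also have "(\<one> (X (X A)) \<otimes> \<sigma> (X A) (X A)) \<cdot> ((Bang \<star> \<epsilon> A) \<otimes> \<epsilon> A \<otimes> e A) = ?E \<otimes> \<epsilon> A"
      using sym_nat[of "e A" "\<epsilon> A" \<I> A] by (simp add: interchange sym_unit_left)
    finally show ?thesis .
  qed
  have "d (X A) \<cdot> Psi A = (d (X A) \<cdot> Ji (X A)) \<cdot> (dc (X A) \<cdot> ?E)"
    by (simp add: Psi_def)
  also have "\<dots> = (G (X A) \<otimes> \<one> (X A)) \<cdot> ((d (X A) \<cdot> dc (X A)) \<cdot> ?E)"
    by (simp add: d_Ji)
  also have "\<dots> = (G (X A) \<otimes> \<one> (X A)) \<cdot> ((dc (X A) \<otimes> \<one> (X A))
        \<cdot> ((\<one> (X (X A)) \<otimes> \<sigma> (X A) (X A)) \<cdot> ((d (X A) \<otimes> \<one> (X A)) \<cdot> ?E)))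
      \<oplus> (G (X A) \<otimes> \<one> (X A)) \<cdot> ?E"
    by (simp add: d_dc distribs)
  also have "\<dots> = ((G (X A) \<otimes> \<one> (X A)) \<cdot> ((dc (X A) \<otimes> \<one> (X A)) \<cdot> (?E \<otimes> \<epsilon> A))) \<cdot> d A
      \<oplus> (G (X A) \<otimes> \<one> (X A)) \<cdot> ?E"
    unfolding E by simp
  also have "(dc (X A) \<otimes> \<one> (X A)) \<cdot> (?E \<otimes> \<epsilon> A) = (dc (X A) \<cdot> ?E) \<otimes> \<epsilon> A"
    using interchange[of "dc (X A)" ?E "\<one> (X A)" "\<epsilon> A"] by simp
  also have "(G (X A) \<otimes> \<one> (X A)) \<cdot> ((dc (X A) \<cdot> ?E) \<otimes> \<epsilon> A)
      = (G (X A) \<cdot> dc (X A) \<cdot> ?E) \<otimes> \<epsilon> A"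
    by (simp add: interchange)
  also have "(G (X A) \<otimes> \<one> (X A)) \<cdot> ?E = (G (X A) \<cdot> (Bang \<star> \<epsilon> A)) \<otimes> e A"
    by (simp add: interchange)
  finally show ?thesis .
qed

text \<open>By the chain rule, \<open>W A \<cdot> G A\<close> and
  \<open>\<delta> A \<cdot> (W (X A) \<cdot> Psi A)\<close> both differentiate \<open>Psi A\<close>
  at \<open>\<delta> A\<close>, in the directions \<open>W A\<close> and identity. By
  \<open>d_Psi\<close> they share the \<open>\<epsilon>\<close> term, while the \<open>e\<close>
  term is zero for the first and \<open>G A\<close> for the second. So \<open>W G + G\<close> is
  \<open>\<delta> W Psi\<close>, and adding one more \<open>G\<close>, which is
  \<open>\<delta> Psi\<close>, gives \<open>\<delta> J Psi\<close>, where \<open>J\<close> cancels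
  the \<open>Ji\<close> in \<open>Psi\<close>.\<close>

lemma J_G:
  assumes [simp]: "A \<in> Obj C"
  shows "(J A \<oplus> \<one> (X A)) \<cdot> G A = \<one> (X A)"
proof -
  let ?H = "G (X A) \<cdot> dc (X A) \<cdot> ((Bang \<star> \<epsilon> A) \<otimes> e A)"
  let ?P = "\<Delta> A \<cdot> ((\<delta> A \<cdot> ?H) \<otimes> \<epsilon> A) \<cdot> d A"
  have dG: "\<delta> A \<cdot> (G (X A) \<cdot> (Bang \<star> \<epsilon> A)) = G A"
  proof -
    have "\<delta> A \<cdot> (G (X A) \<cdot> (Bang \<star> \<epsilon> A)) = (\<delta> A \<cdot> (Bang \<star> \<epsilon> A)) \<cdot> G A"
      by (simp flip: G_nat_epsilon)
    then show ?thesis by (simp add: delta_bang_epsilon)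
  qed
  \<comment> \<open>The direction \<open>v\<close> will be \<open>W A\<close> and the identity; both
    fix \<open>\<epsilon> A\<close>, which makes the summand \<open>?P\<close> common to
    them.\<close>
  have key: "\<Delta> A \<cdot> ((\<delta> A \<otimes> v) \<cdot> (d (X A) \<cdot> Psi A)) = ?P \<oplus> \<Delta> A \<cdot> (G A \<otimes> (v \<cdot> e A))"
    if [simp]: "v \<in> Arr C" "Dom C v = X A" "Cod C v = X A" and v: "v \<cdot> \<epsilon> A = \<epsilon> A" for v
  proof -
    have "\<Delta> A \<cdot> ((\<delta> A \<otimes> v) \<cdot> (d (X A) \<cdot> Psi A))
        = \<Delta> A \<cdot> (((\<delta> A \<otimes> v) \<cdot> (?H \<otimes> \<epsilon> A)) \<cdot> d A)
          \<oplus> \<Delta> A \<cdot> ((\<delta> A \<otimes> v) \<cdot> ((G (X A) \<cdot> (Bang \<star> \<epsilon> A)) \<otimes> e A))"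
      by (simp add: d_Psi distribs)
    also have "(\<delta> A \<otimes> v) \<cdot> (?H \<otimes> \<epsilon> A) = (\<delta> A \<cdot> ?H) \<otimes> \<epsilon> A"
      using interchange[of "\<delta> A" ?H v "\<epsilon> A"] v by simp
    also have "(\<delta> A \<otimes> v) \<cdot> ((G (X A) \<cdot> (Bang \<star> \<epsilon> A)) \<otimes> e A) = G A \<otimes> (v \<cdot> e A)"
      using interchange[of "\<delta> A" "G (X A) \<cdot> (Bang \<star> \<epsilon> A)" v "e A"] by (simp add: dG)
    finally show ?thesis by simp
  qed
  have "\<Delta> A \<cdot> (G A \<otimes> e A) = (\<Delta> A \<cdot> (\<one> (X A) \<otimes> e A)) \<cdot> G A"
    using slide[of "G A" "e A"] interchange[of "\<one> (X A)" "G A" "e A" "\<one> \<I>"] by simp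
  then have Ge: "\<Delta> A \<cdot> (G A \<otimes> e A) = G A" by (simp add: counit)
  have WG: "W A \<cdot> G A = ?P"
  proof -
    have "W A \<cdot> G A = (W A \<cdot> \<delta> A) \<cdot> Psi A" by (simp add: G_def)
    also have "\<dots> = \<Delta> A \<cdot> ((\<delta> A \<otimes> W A) \<cdot> (d (X A) \<cdot> Psi A))"
      by (simp only: W_delta assms) simp
    also have "\<dots> = ?P \<oplus> \<Delta> A \<cdot> (G A \<otimes> (W A \<cdot> e A))"
      by (rule key) (simp_all add: W_epsilon del: assoc)
    finally show ?thesis by (simp add: d1)
  qed
  have dWP: "\<delta> A \<cdot> (W (X A) \<cdot> Psi A) = ?P \<oplus> G A"
  proof -
    have "\<delta> A \<cdot> (W (X A) \<cdot> Psi A) = (\<delta> A \<cdot> dc (X A)) \<cdot> (d (X A) \<cdot> Psi A)" by simp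
    also have "\<dots> = \<Delta> A \<cdot> ((\<delta> A \<otimes> \<one> (X A)) \<cdot> (d (X A) \<cdot> Psi A))"
      by (simp add: delta_dc)
    also have "\<dots> = ?P \<oplus> \<Delta> A \<cdot> (G A \<otimes> (\<one> (X A) \<cdot> e A))"
      by (rule key) simp_all
    finally show ?thesis by (simp add: Ge)
  qed
  have "(J A \<oplus> \<one> (X A)) \<cdot> G A = W A \<cdot> G A \<oplus> G A \<oplus> G A"
    by (simp add: J_eq distribs)
  also have "\<dots> = \<delta> A \<cdot> (W (X A) \<cdot> Psi A) \<oplus> \<delta> A \<cdot> Psi A"
    by (simp only: WG dWP) (simp add: G_def)
  also have "\<dots> = \<delta> A \<cdot> (J (X A) \<cdot> Psi A)"
    by (simp add: J_eq distribs)
  also have "\<dots> = \<one> (X A)"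
    by (simp add: Psi_def delta_dc_counits)
  finally show ?thesis .
qed

text \<open>Counterpart of \<open>d_Ji\<close>, resting on the half \<open>J_G\<close>.\<close>

lemma Ji_dc:
  assumes [simp]: "A \<in> Obj C"
  shows "Ji A \<cdot> dc A = dc A \<cdot> (G A \<otimes> \<one> A)"
proof -
  have "dc A \<cdot> (G A \<otimes> \<one> A) = Ji A \<cdot> ((J A \<cdot> dc A) \<cdot> (G A \<otimes> \<one> A))" by simp
  also have "\<dots> = Ji A \<cdot> (dc A \<cdot> (((J A \<oplus> \<one> (X A)) \<cdot> G A) \<otimes> \<one> A))"
    by (simp only: J_dc assms) (simp add: interchange)
  finally show ?thesis by (simp add: J_G)
qed

text \<open>On functions homogeneous of degrees \<open>m\<close> and \<open>n\<close> this says
  \<open>(1/(m+1) + 1/(n+1)) / (m+n+2) = 1/(m+1) * 1/(n+1)\<close>; it is the reason for the Rota--Baxter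
  rule [s.2].\<close>
lemma G_Delta:
  assumes [simp]: "A \<in> Obj C"
  shows "G A \<cdot> \<Delta> A \<cdot> (Ji A \<otimes> \<one> (X A)) \<oplus> G A \<cdot> \<Delta> A \<cdot> (\<one> (X A) \<otimes> Ji A) = \<Delta> A \<cdot> (Ji A \<otimes> Ji A)"
proof -
  have "\<Delta> A \<cdot> (Ji A \<otimes> Ji A) = G A \<cdot> (((J A \<oplus> \<one> (X A)) \<cdot> \<Delta> A) \<cdot> (Ji A \<otimes> Ji A))"
  proof -
    \<comment> \<open>Inserting \<open>G (J + 1) = 1\<close> in front makes \<open>J_Delta\<close>
      applicable; each \<open>J\<close> it produces then cancels one of the two
      \<open>Ji\<close>.\<close>
    have "\<Delta> A \<cdot> (Ji A \<otimes> Ji A) = (G A \<cdot> (J A \<oplus> \<one> (X A))) \<cdot> (\<Delta> A \<cdot> (Ji A \<otimes> Ji A))"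
      by (simp only: G_J assms) simp
    then show ?thesis by simp
  qed
  also have "\<dots> = G A \<cdot> (\<Delta> A \<cdot> ((J A \<otimes> \<one> (X A) \<oplus> \<one> (X A) \<otimes> J A) \<cdot> (Ji A \<otimes> Ji A)))"
    by (simp only: J_Delta assms) simp
  also have "(J A \<otimes> \<one> (X A) \<oplus> \<one> (X A) \<otimes> J A) \<cdot> (Ji A \<otimes> Ji A)
      = \<one> (X A) \<otimes> Ji A \<oplus> Ji A \<otimes> \<one> (X A)"
    by (simp add: distribs interchange)
  also have "\<dots> = Ji A \<otimes> \<one> (X A) \<oplus> \<one> (X A) \<otimes> Ji A"
    by (rule plus_ac) simp_all
  finally show ?thesis by (simp add: distribs)
qed

section \<open>The integral transformation axioms and the Poincare condition\<close>

abbreviation s :: "'o \<Rightarrow> 'm" where "s \<equiv> J_integral C Bang \<epsilon> \<Delta> d"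

lemma s_eq: "s A = dc A \<cdot> (Ji A \<otimes> \<one> A)"
  by (simp add: J_integral_def)

lemma s_arr [simp]:
  assumes "A \<in> Obj C"
  shows "s A \<in> Arr C" "Dom C (s A) = X A" "Cod C (s A) = X A \<boxtimes> A"
  using assms by (simp_all add: s_eq)

lemma s_nat:
  assumes [simp]: "f \<in> Arr C" "Dom C f = A" "Cod C f = B"
  shows "(Bang \<star> f) \<cdot> s B = s A \<cdot> ((Bang \<star> f) \<otimes> f)"
proof -
  have [simp]: "A \<in> Obj C" "B \<in> Obj C" using dom_cod_obj[of f] by simp_all
  have "(Bang \<star> f) \<cdot> s B = ((Bang \<star> f) \<cdot> dc B) \<cdot> (Ji B \<otimes> \<one> B)"
    by (simp add: s_eq)
  also have "\<dots> = dc A \<cdot> (((Bang \<star> f) \<cdot> Ji B) \<otimes> f)"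
    by (simp add: dc_natural[of f A B] interchange)
  also have "\<dots> = s A \<cdot> ((Bang \<star> f) \<otimes> f)"
    by (simp add: Ji_nat[of f A B] s_eq interchange)
  finally show ?thesis .
qed

lemma s_natural: "natural_transformation C Bang (tensor_functor C Bang id_functor) s"
  by (auto simp: natural_transformation_def hom_def tensor_functor_def id_functor_def s_nat)

lemma s_counit:
  assumes [simp]: "A \<in> Obj C"
  shows "s A \<cdot> (e A \<otimes> \<one> A) = \<epsilon> A"
proof -
  have "s A \<cdot> (e A \<otimes> \<one> A) = dc A \<cdot> ((Ji A \<cdot> e A) \<otimes> \<one> A)"
    using interchange[of "Ji A" "e A" "\<one> A" "\<one> A"] by (simp add: s_eq)
  then show ?thesis by (simp add: Ji_e dc_counit)
qed

text \<open>The map \<open>k\<close> does not touch the two extracted arguments, so the swap slides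
  past it to \<open>dc_dc_sym\<close>. The codomain \<open>Y\<close> is free because [s.3] has
  \<open>k\<close> ending in \<open>X A\<close> and [s.2] in
  \<open>X A \<boxtimes> X A\<close>.\<close>

lemma dc_dc_slide_sym:
  assumes [simp]: "A \<in> Obj C" "k \<in> Arr C" "Dom C k = X A" "Cod C k = Y"
  shows "dc A \<cdot> (dc A \<otimes> \<one> A) \<cdot> (k \<otimes> \<one> A \<otimes> \<one> A) \<cdot> (\<one> Y \<otimes> \<sigma> A A)
    = dc A \<cdot> (dc A \<otimes> \<one> A) \<cdot> (k \<otimes> \<one> A \<otimes> \<one> A)"
proof -
  have [simp]: "Y \<in> Obj C" using dom_cod_obj(2)[of k] by simp
  have "dc A \<cdot> (dc A \<otimes> \<one> A) \<cdot> (k \<otimes> \<one> A \<otimes> \<one> A) \<cdot> (\<one> Y \<otimes> \<sigma> A A)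
      = (dc A \<cdot> (dc A \<otimes> \<one> A) \<cdot> (\<one> (X A) \<otimes> \<sigma> A A)) \<cdot> (k \<otimes> \<one> A \<otimes> \<one> A)"
    using slide[of k "\<sigma> A A"] by simp
  then show ?thesis by (simp only: dc_dc_sym assms)
qed

text \<open>\<open>Ji_dc\<close> moves the inner \<open>Ji\<close> past the second
  \<open>dc\<close>, which collects everything acting on the \<open>X A\<close> factor into the
  single map \<open>G A \<cdot> Ji A\<close>.\<close>

lemma s_s_sym:
  assumes [simp]: "A \<in> Obj C"
  shows "s A \<cdot> (s A \<otimes> \<one> A) = s A \<cdot> (s A \<otimes> \<one> A) \<cdot> (\<one> (X A) \<otimes> \<sigma> A A)"
proof -
  have "s A \<cdot> (s A \<otimes> \<one> A) = dc A \<cdot> (((Ji A \<cdot> dc A) \<otimes> \<one> A) \<cdot> (Ji A \<otimes> \<one> A \<otimes> \<one> A))"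
    by (simp add: s_eq whisker_right)
  also have "\<dots> = dc A \<cdot> (dc A \<otimes> \<one> A) \<cdot> ((G A \<cdot> Ji A) \<otimes> \<one> A \<otimes> \<one> A)"
    by (simp add: Ji_dc interchange whisker_right)
  finally have eq: "s A \<cdot> (s A \<otimes> \<one> A) = dc A \<cdot> (dc A \<otimes> \<one> A) \<cdot> ((G A \<cdot> Ji A) \<otimes> \<one> A \<otimes> \<one> A)" .
  show ?thesis
    unfolding eq by (rule dc_dc_slide_sym[symmetric]) simp_all
qed

text \<open>This and \<open>Delta_s_right\<close> bring \<open>dc\<close> to the front, so that
  \<open>Ji\<close> acts directly on the copies made by \<open>\<Delta>\<close>.\<close>

lemma Delta_s_left:
  assumes [simp]: "A \<in> Obj C"
  shows "\<Delta> A \<cdot> (s A \<otimes> \<one> (X A))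
    = dc A \<cdot> ((\<Delta> A \<cdot> (Ji A \<otimes> \<one> (X A))) \<otimes> \<one> A) \<cdot> (\<one> (X A) \<otimes> \<sigma> (X A) A)"
proof -
  have "\<Delta> A \<cdot> (s A \<otimes> \<one> (X A)) = (\<Delta> A \<cdot> (dc A \<otimes> \<one> (X A))) \<cdot> (Ji A \<otimes> \<one> A \<otimes> \<one> (X A))"
    by (simp add: s_eq whisker_right)
  also have "\<dots> = dc A \<cdot> ((\<Delta> A \<otimes> \<one> A)
      \<cdot> ((\<one> (X A) \<otimes> \<sigma> (X A) A) \<cdot> (Ji A \<otimes> \<one> A \<otimes> \<one> (X A))))"
    by (simp flip: dc_Delta_sym)
  also have "\<dots> = dc A \<cdot> ((\<Delta> A \<cdot> (Ji A \<otimes> \<one> (X A))) \<otimes> \<one> A) \<cdot> (\<one> (X A) \<otimes> \<sigma> (X A) A)"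
    using slide[of "Ji A" "\<sigma> (X A) A"] by (simp add: whisker_right)
  finally show ?thesis .
qed

lemma Delta_s_right:
  assumes [simp]: "A \<in> Obj C"
  shows "\<Delta> A \<cdot> (\<one> (X A) \<otimes> s A) = dc A \<cdot> ((\<Delta> A \<cdot> (\<one> (X A) \<otimes> Ji A)) \<otimes> \<one> A)"
proof -
  have "\<Delta> A \<cdot> (\<one> (X A) \<otimes> s A) = (\<Delta> A \<cdot> (\<one> (X A) \<otimes> dc A)) \<cdot> (\<one> (X A) \<otimes> Ji A \<otimes> \<one> A)"
    by (simp add: s_eq whisker_left)
  also have "\<dots> = dc A \<cdot> ((\<Delta> A \<cdot> (\<one> (X A) \<otimes> Ji A)) \<otimes> \<one> A)"
    by (simp add: whisker_right flip: dc_Delta)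
  finally show ?thesis .
qed

text \<open>Naturality moves \<open>s\<close> across the symmetry, and the hexagon splits the
  resulting symmetry. Afterwards \<open>s\<close> stands where \<open>Delta_s_right\<close>
  applies.\<close>

lemma sym_s:
  assumes [simp]: "A \<in> Obj C"
  shows "(\<one> (X A) \<otimes> \<sigma> (X A) A) \<cdot> (\<one> (X A) \<otimes> \<one> A \<otimes> s A)
    = (\<one> (X A) \<otimes> s A \<otimes> \<one> A) \<cdot> (\<one> (X A) \<otimes> \<one> (X A) \<otimes> \<sigma> A A)
      \<cdot> (\<one> (X A) \<otimes> \<sigma> (X A) A \<otimes> \<one> A)"
proof -
  have "\<sigma> (X A) A \<cdot> (\<one> A \<otimes> s A) = (s A \<otimes> \<one> A) \<cdot> \<sigma> (X A \<boxtimes> A) A"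
    using sym_nat[of "s A" "\<one> A" "X A \<boxtimes> A" A] by simp
  also have "\<dots> = (s A \<otimes> \<one> A) \<cdot> ((\<one> (X A) \<otimes> \<sigma> A A) \<cdot> (\<sigma> (X A) A \<otimes> \<one> A))"
    by (simp add: sym_hexagon')
  finally have "\<one> (X A) \<otimes> (\<sigma> (X A) A \<cdot> (\<one> A \<otimes> s A))
      = \<one> (X A) \<otimes> ((s A \<otimes> \<one> A) \<cdot> ((\<one> (X A) \<otimes> \<sigma> A A) \<cdot> (\<sigma> (X A) A \<otimes> \<one> A)))"
    by simp
  then show ?thesis by (simp add: whisker_left)
qed

text \<open>Each of the three terms is brought to a common normal form \<open>N k\<close>: two
  extractions by \<open>dc\<close>, a map \<open>k\<close> on the remaining \<open>X A\<close>, and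
  a fixed rearrangement. \<open>N\<close> is additive in \<open>k\<close>, and the three values of
  \<open>k\<close> satisfy \<open>G_Delta\<close>.\<close>

lemma s_Rota_Baxter:
  assumes [simp]: "A \<in> Obj C"
  shows "\<Delta> A \<cdot> (s A \<otimes> s A) =
      s A \<cdot> (\<Delta> A \<otimes> \<one> A) \<cdot> (s A \<otimes> \<one> (X A) \<otimes> \<one> A)
      \<oplus> s A \<cdot> (\<Delta> A \<otimes> \<one> A) \<cdot> (\<one> (X A) \<otimes> \<sigma> (X A) A) \<cdot> (\<one> (X A) \<otimes> \<one> A \<otimes> s A)"
proof -
  let ?c = "\<one> (X A) \<otimes> \<sigma> (X A) A \<otimes> \<one> A"
  define N where "N k = dc A \<cdot> (dc A \<otimes> \<one> A) \<cdot> (k \<otimes> \<one> A \<otimes> \<one> A) \<cdot> ?c" for k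
  \<comment> \<open>The extra symmetry is the one that \<open>sym_s\<close> creates in
    \<open>L\<close> and \<open>R2\<close>; it swaps the two extracted arguments and so
    disappears.\<close>
  have N: "dc A \<cdot> (((dc A \<cdot> (k \<otimes> \<one> A)) \<otimes> \<one> A)
      \<cdot> ((\<one> (X A) \<otimes> \<one> (X A) \<otimes> \<sigma> A A) \<cdot> ?c)) = N k"
    if [simp]: "k \<in> Arr C" "Dom C k = X A" "Cod C k = X A \<boxtimes> X A" for k
  proof -
    have "dc A \<cdot> (((dc A \<cdot> (k \<otimes> \<one> A)) \<otimes> \<one> A)
        \<cdot> ((\<one> (X A) \<otimes> \<one> (X A) \<otimes> \<sigma> A A) \<cdot> ?c))
        = (dc A \<cdot> (dc A \<otimes> \<one> A) \<cdot> (k \<otimes> \<one> A \<otimes> \<one> A) \<cdot> (\<one> (X A \<boxtimes> X A) \<otimes> \<sigma> A A)) \<cdot> ?c"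
      by (simp add: whisker_right)
    then show ?thesis
      unfolding N_def by (simp only: dc_dc_slide_sym assms that)
  qed
  have L: "\<Delta> A \<cdot> (s A \<otimes> s A) = N (\<Delta> A \<cdot> (Ji A \<otimes> Ji A))"
  proof -
    have "\<Delta> A \<cdot> (s A \<otimes> s A) = (\<Delta> A \<cdot> (s A \<otimes> \<one> (X A))) \<cdot> (\<one> (X A) \<otimes> \<one> A \<otimes> s A)"
      using tensor_left_first[of "s A" "s A"] by simp
    also have "\<dots> = dc A \<cdot> (((\<Delta> A \<cdot> (Ji A \<otimes> \<one> (X A))) \<otimes> \<one> A)
        \<cdot> ((\<one> (X A) \<otimes> \<sigma> (X A) A) \<cdot> (\<one> (X A) \<otimes> \<one> A \<otimes> s A)))"
      by (simp only: Delta_s_left assms) simp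
    also have "\<dots> = dc A \<cdot> (((\<Delta> A \<cdot> ((Ji A \<otimes> \<one> (X A)) \<cdot> (\<one> (X A) \<otimes> s A))) \<otimes> \<one> A)
        \<cdot> ((\<one> (X A) \<otimes> \<one> (X A) \<otimes> \<sigma> A A) \<cdot> ?c))"
      by (simp only: sym_s assms) (simp add: whisker_right)
    also have "\<Delta> A \<cdot> ((Ji A \<otimes> \<one> (X A)) \<cdot> (\<one> (X A) \<otimes> s A))
        = (\<Delta> A \<cdot> (\<one> (X A) \<otimes> s A)) \<cdot> (Ji A \<otimes> \<one> (X A) \<otimes> \<one> A)"
      using slide[of "Ji A" "s A"] by simp
    also have "\<dots> = dc A \<cdot> ((\<Delta> A \<cdot> (Ji A \<otimes> Ji A)) \<otimes> \<one> A)"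
      using tensor_right_first[of "Ji A" "Ji A"]
        whisker_right[of "\<one> (X A) \<otimes> Ji A" "Ji A \<otimes> \<one> (X A)" A]
      by (simp add: Delta_s_right whisker_right)
    finally show ?thesis by (simp only:) (rule N, simp_all)
  qed
  have R1: "s A \<cdot> (\<Delta> A \<otimes> \<one> A) \<cdot> (s A \<otimes> \<one> (X A) \<otimes> \<one> A)
      = N (G A \<cdot> \<Delta> A \<cdot> (Ji A \<otimes> \<one> (X A)))"
  proof -
    have "s A \<cdot> (\<Delta> A \<otimes> \<one> A) \<cdot> (s A \<otimes> \<one> (X A) \<otimes> \<one> A)
        = dc A \<cdot> ((Ji A \<cdot> (\<Delta> A \<cdot> (s A \<otimes> \<one> (X A)))) \<otimes> \<one> A)"
      by (simp add: s_eq[of A] whisker_right whisker_right_tensor)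
    also have "Ji A \<cdot> (\<Delta> A \<cdot> (s A \<otimes> \<one> (X A)))
        = (Ji A \<cdot> dc A) \<cdot> ((\<Delta> A \<cdot> (Ji A \<otimes> \<one> (X A))) \<otimes> \<one> A) \<cdot> (\<one> (X A) \<otimes> \<sigma> (X A) A)"
      by (simp only: Delta_s_left assms) simp
    also have "\<dots> = dc A \<cdot> ((G A \<cdot> \<Delta> A \<cdot> (Ji A \<otimes> \<one> (X A))) \<otimes> \<one> A) \<cdot> (\<one> (X A) \<otimes> \<sigma> (X A) A)"
      by (simp add: Ji_dc whisker_right)
    finally show ?thesis by (simp add: N_def whisker_right whisker_right_tensor)
  qed
  have R2: "s A \<cdot> (\<Delta> A \<otimes> \<one> A) \<cdot> (\<one> (X A) \<otimes> \<sigma> (X A) A) \<cdot> (\<one> (X A) \<otimes> \<one> A \<otimes> s A)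
      = N (G A \<cdot> \<Delta> A \<cdot> (\<one> (X A) \<otimes> Ji A))"
  proof -
    have "s A \<cdot> (\<Delta> A \<otimes> \<one> A) \<cdot> (\<one> (X A) \<otimes> \<sigma> (X A) A) \<cdot> (\<one> (X A) \<otimes> \<one> A \<otimes> s A)
        = s A \<cdot> ((\<Delta> A \<otimes> \<one> A) \<cdot> ((\<one> (X A) \<otimes> \<sigma> (X A) A) \<cdot> (\<one> (X A) \<otimes> \<one> A \<otimes> s A)))"
      by simp
    also have "\<dots> = dc A \<cdot> (((Ji A \<cdot> (\<Delta> A \<cdot> (\<one> (X A) \<otimes> s A))) \<otimes> \<one> A)
        \<cdot> ((\<one> (X A) \<otimes> \<one> (X A) \<otimes> \<sigma> A A) \<cdot> ?c))"
      by (simp only: sym_s assms) (simp add: s_eq[of A] whisker_right)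
    also have "Ji A \<cdot> (\<Delta> A \<cdot> (\<one> (X A) \<otimes> s A))
        = (Ji A \<cdot> dc A) \<cdot> ((\<Delta> A \<cdot> (\<one> (X A) \<otimes> Ji A)) \<otimes> \<one> A)"
      by (simp add: Delta_s_right)
    also have "\<dots> = dc A \<cdot> ((G A \<cdot> \<Delta> A \<cdot> (\<one> (X A) \<otimes> Ji A)) \<otimes> \<one> A)"
      by (simp add: Ji_dc whisker_right)
    finally show ?thesis by (simp only:) (rule N, simp_all)
  qed
  have "N (\<Delta> A \<cdot> (Ji A \<otimes> Ji A))
      = N (G A \<cdot> \<Delta> A \<cdot> (Ji A \<otimes> \<one> (X A)) \<oplus> G A \<cdot> \<Delta> A \<cdot> (\<one> (X A) \<otimes> Ji A))"
    by (simp only: G_Delta assms)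
  also have "\<dots> = N (G A \<cdot> \<Delta> A \<cdot> (Ji A \<otimes> \<one> (X A))) \<oplus> N (G A \<cdot> \<Delta> A \<cdot> (\<one> (X A) \<otimes> Ji A))"
    by (simp add: N_def distribs)
  finally show ?thesis by (simp only: L R1 R2)
qed

text \<open>The \<open>Ji\<close> behind \<open>d\<close> becomes \<open>G\<close> in front of it,
  slides past the symmetry, and returns as \<open>Ji\<close> in front of \<open>dc\<close>. What is
  left behind, the symmetry followed by \<open>d A \<otimes> \<one> A\<close>, is exactly what the
  Poincare hypothesis speaks about.\<close>

lemma d_s:
  assumes [simp]: "A \<in> Obj C"
  shows "d A \<cdot> s A
    = ((Ji A \<cdot> dc A) \<otimes> \<one> A) \<cdot> (\<one> (X A) \<otimes> \<sigma> A A) \<cdot> (d A \<otimes> \<one> A) \<oplus> Ji A \<otimes> \<one> A"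
proof -
  have "d A \<cdot> s A = (d A \<cdot> dc A) \<cdot> (Ji A \<otimes> \<one> A)" by (simp add: s_eq)
  also have "\<dots> = (dc A \<otimes> \<one> A) \<cdot> ((\<one> (X A) \<otimes> \<sigma> A A) \<cdot> ((d A \<cdot> Ji A) \<otimes> \<one> A)) \<oplus> Ji A \<otimes> \<one> A"
    by (simp add: d_dc distribs whisker_right)
  also have "\<dots> = (dc A \<otimes> \<one> A) \<cdot> (((\<one> (X A) \<otimes> \<sigma> A A) \<cdot> (G A \<otimes> \<one> A \<otimes> \<one> A)) \<cdot> (d A \<otimes> \<one> A))
      \<oplus> Ji A \<otimes> \<one> A"
    by (simp add: d_Ji whisker_right)
  also have "(\<one> (X A) \<otimes> \<sigma> A A) \<cdot> (G A \<otimes> \<one> A \<otimes> \<one> A) = (G A \<otimes> \<one> A \<otimes> \<one> A) \<cdot> (\<one> (X A) \<otimes> \<sigma> A A)"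
    using slide[of "G A" "\<sigma> A A"] by simp
  also have "(dc A \<otimes> \<one> A) \<cdot> (((G A \<otimes> \<one> A \<otimes> \<one> A) \<cdot> (\<one> (X A) \<otimes> \<sigma> A A)) \<cdot> (d A \<otimes> \<one> A))
      = ((dc A \<cdot> (G A \<otimes> \<one> A)) \<otimes> \<one> A) \<cdot> (\<one> (X A) \<otimes> \<sigma> A A) \<cdot> (d A \<otimes> \<one> A)"
    by (simp add: whisker_right)
  finally show ?thesis by (simp add: Ji_dc)
qed

lemma poincare: "poincare_condition C Bang d s"
  unfolding poincare_condition_def
proof (intro ballI impI)
  fix A B D f
  assume [simp]: "A \<in> Obj C" "B \<in> Obj C" "D \<in> Obj C"
    and "f \<in> hom C (D \<boxtimes> X A \<boxtimes> A) B"
    and sym: "(\<one> D \<otimes> \<one> (X A) \<otimes> \<sigma> A A) \<cdot> (\<one> D \<otimes> d A \<otimes> \<one> A) \<cdot> f = (\<one> D \<otimes> d A \<otimes> \<one> A) \<cdot> f"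
  then have [simp]: "f \<in> Arr C" "Dom C f = D \<boxtimes> X A \<boxtimes> A" "Cod C f = B"
    by (simp_all add: hom_def)
  have "Ji A \<cdot> (W A \<oplus> \<one> (X A)) = \<one> (X A)"
    by (simp flip: J_eq)
  then have Ji_W: "Ji A \<cdot> (dc A \<cdot> d A) \<oplus> Ji A = \<one> (X A)"
    by (simp add: distribs)
  have "(\<one> D \<otimes> (d A \<cdot> s A)) \<cdot> f
      = (\<one> D \<otimes> (Ji A \<cdot> dc A) \<otimes> \<one> A)
          \<cdot> ((\<one> D \<otimes> \<one> (X A) \<otimes> \<sigma> A A) \<cdot> (\<one> D \<otimes> d A \<otimes> \<one> A) \<cdot> f)
        \<oplus> (\<one> D \<otimes> Ji A \<otimes> \<one> A) \<cdot> f"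
    by (simp add: d_s distribs whisker_left)
  \<comment> \<open>The hypothesis on \<open>f\<close> deletes the symmetry, so that
    \<open>dc\<close> meets \<open>d\<close> and the two summands combine to
    \<open>Ji (W + 1)\<close> acting on the \<open>X A\<close> factor.\<close>
  also have "\<dots> = (\<one> D \<otimes> (Ji A \<cdot> dc A) \<otimes> \<one> A) \<cdot> ((\<one> D \<otimes> d A \<otimes> \<one> A) \<cdot> f)
      \<oplus> (\<one> D \<otimes> Ji A \<otimes> \<one> A) \<cdot> f"
    by (simp only: sym)
  also have "\<dots> = (\<one> D \<otimes> (Ji A \<cdot> (dc A \<cdot> d A) \<oplus> Ji A) \<otimes> \<one> A) \<cdot> f"
    by (simp add: distribs whisker_left whisker_right)
  also have "\<dots> = f"
    unfolding Ji_W by simp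
  finally show "(\<one> D \<otimes> (d A \<cdot> s A)) \<cdot> f = f" .
qed

end

theorem proposition6p7:
  fixes C :: "('o, 'm, 'x) additive_smc_scheme"
    and Bang :: "('o, 'm) endofunctor"
    and \<delta> \<epsilon> \<Delta> e d :: "'o \<Rightarrow> 'm"
  assumes "differential_category C Bang \<delta> \<epsilon> \<Delta> e d"
    and "natural_isomorphism C Bang Bang (J_transformation C Bang \<epsilon> \<Delta> d)"
  shows "integral_transformation C Bang \<delta> \<epsilon> \<Delta> e (J_integral C Bang \<epsilon> \<Delta> d)
    \<and> poincare_condition C Bang d (J_integral C Bang \<epsilon> \<Delta> d)"
proof -
  interpret differential_category_J C Bang \<delta> \<epsilon> \<Delta> e d
    using assms by (intro differential_category_J.intro differential_category_J_axioms.intro)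
  have "integral_transformation C Bang \<delta> \<epsilon> \<Delta> e s"
    by unfold_locales (fact s_natural s_counit s_Rota_Baxter s_s_sym)+
  then show ?thesis using poincare by simp
qed

end
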